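(* Let $n\ge 2$ and $r\ge1$ be integers and let $a\in\mathbb{C}^\times$. The linear map $\psi_{a,n,r}:L(\mathfrak{gl}_n)\to\mathrm{End}(V_{n,r})$ defined by $$\psi_{a,n,r}(E_{i,k}(m))=a^m\sum_{j,s=0}^{r-1}\ell_{j,r}(m+s)\,x_{i,j}\frac{\partial}{\partial x_{k,s}}\qquad(1\le i,k\le n,\ m\in\mathbb{Z})$$ is a Lie algebra homomorphism.
   Context: $E_{i,k}$ are the matrix units of $\mathfrak{gl}_n=\mathfrak{gl}_n(\mathbb{C})$. $L(\mathfrak{gl}_n)=\mathfrak{gl}_n\otimes\mathbb{C}[t,t^{-1}]$ is the loop algebra with bracket $[x(m),y(k)]=[x,y](m+k)$, where $x(m)=x\otimes t^m$. $V_{n,r}=\Lambda[y_{i,j}\mid 1\le i\le n,\ 0\le j\le r-1]$ is the exterior algebra over $\mathbb{C}$ on the variables $y_{i,j}$. Put $x_{i,j}=\sum_{k=0}^{j}\binom{j}{k}y_{i,r-1-k}$ for $1\le i\le n$, $0\le j\le r-1$; these also freely generate $V_{n,r}$ as an exterior algebra, and $\partial/\partial x_{k,s}$ denotes the corresponding (odd, left) partial derivative with respect to the generators $x_{i,j}$; $x_{i,j}$ acts by left multiplication. $\ell_{j,r}(t)=\prod_{0\le i\le r-1,\ i\ne j}\frac{t-i}{j-i}$ is the Lagrange interpolation polynomial of degree $r-1$ ($0\le j\le r-1$). $\mathrm{End}(V_{n,r})$ carries the commutator bracket. *)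

theory Defs
  imports
    Complex_Main
    "HOL-Library.FuncSet"
    "HOL-Library.Function_Algebras"
    "HOL-Library.Product_Lexorder"
begin

section \<open>Complex Lie algebras and their homomorphisms\<close>

record 'a lie_alg =
  lcarrier :: "'a set"
  ladd :: "'a \<Rightarrow> 'a \<Rightarrow> 'a"
  lzero :: "'a"
  lscale :: "complex \<Rightarrow> 'a \<Rightarrow> 'a"
  lbracket :: "'a \<Rightarrow> 'a \<Rightarrow> 'a"

locale complex_lie_algebra =
  fixes L :: "'a lie_alg"
  assumes add_closed: "\<lbrakk>x \<in> lcarrier L; y \<in> lcarrier L\<rbrakk> \<Longrightarrow> ladd L x y \<in> lcarrier L"
    and zero_closed: "lzero L \<in> lcarrier L"
    and scale_closed: "x \<in> lcarrier L \<Longrightarrow> lscale L c x \<in> lcarrier L"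
    and bracket_closed: "\<lbrakk>x \<in> lcarrier L; y \<in> lcarrier L\<rbrakk> \<Longrightarrow> lbracket L x y \<in> lcarrier L"
    and add_assoc: "\<lbrakk>x \<in> lcarrier L; y \<in> lcarrier L; z \<in> lcarrier L\<rbrakk>
      \<Longrightarrow> ladd L (ladd L x y) z = ladd L x (ladd L y z)"
    and add_comm: "\<lbrakk>x \<in> lcarrier L; y \<in> lcarrier L\<rbrakk> \<Longrightarrow> ladd L x y = ladd L y x"
    and add_zero: "x \<in> lcarrier L \<Longrightarrow> ladd L (lzero L) x = x"
    and add_inverse: "x \<in> lcarrier L \<Longrightarrow> \<exists>y\<in>lcarrier L. ladd L x y = lzero L"
    and scale_one: "x \<in> lcarrier L \<Longrightarrow> lscale L 1 x = x"
    and scale_scale: "x \<in> lcarrier L \<Longrightarrow> lscale L c (lscale L d x) = lscale L (c * d) x"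
    and scale_add_left: "x \<in> lcarrier L \<Longrightarrow> lscale L (c + d) x = ladd L (lscale L c x) (lscale L d x)"
    and scale_add_right: "\<lbrakk>x \<in> lcarrier L; y \<in> lcarrier L\<rbrakk>
      \<Longrightarrow> lscale L c (ladd L x y) = ladd L (lscale L c x) (lscale L c y)"
    and bracket_add_left: "\<lbrakk>x \<in> lcarrier L; y \<in> lcarrier L; z \<in> lcarrier L\<rbrakk>
      \<Longrightarrow> lbracket L (ladd L x y) z = ladd L (lbracket L x z) (lbracket L y z)"
    and bracket_add_right: "\<lbrakk>x \<in> lcarrier L; y \<in> lcarrier L; z \<in> lcarrier L\<rbrakk>
      \<Longrightarrow> lbracket L z (ladd L x y) = ladd L (lbracket L z x) (lbracket L z y)"
    and bracket_scale_left: "\<lbrakk>x \<in> lcarrier L; y \<in> lcarrier L\<rbrakk>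
      \<Longrightarrow> lbracket L (lscale L c x) y = lscale L c (lbracket L x y)"
    and bracket_scale_right: "\<lbrakk>x \<in> lcarrier L; y \<in> lcarrier L\<rbrakk>
      \<Longrightarrow> lbracket L x (lscale L c y) = lscale L c (lbracket L x y)"
    and bracket_self: "x \<in> lcarrier L \<Longrightarrow> lbracket L x x = lzero L"
    and jacobi: "\<lbrakk>x \<in> lcarrier L; y \<in> lcarrier L; z \<in> lcarrier L\<rbrakk>
      \<Longrightarrow> ladd L (lbracket L x (lbracket L y z))
            (ladd L (lbracket L y (lbracket L z x)) (lbracket L z (lbracket L x y))) = lzero L"

locale lie_algebra_hom =
  source: complex_lie_algebra L + target: complex_lie_algebra M
  for L :: "'a lie_alg" and M :: "'b lie_alg" and f :: "'a \<Rightarrow> 'b" +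
  assumes hom_closed: "x \<in> lcarrier L \<Longrightarrow> f x \<in> lcarrier M"
    and hom_add: "\<lbrakk>x \<in> lcarrier L; y \<in> lcarrier L\<rbrakk> \<Longrightarrow> f (ladd L x y) = ladd M (f x) (f y)"
    and hom_scale: "x \<in> lcarrier L \<Longrightarrow> f (lscale L c x) = lscale M c (f x)"
    and hom_bracket: "\<lbrakk>x \<in> lcarrier L; y \<in> lcarrier L\<rbrakk>
      \<Longrightarrow> f (lbracket L x y) = lbracket M (f x) (f y)"

section \<open>The loop algebra of \<open>gl\<^sub>n\<close>\<close>

text \<open>
  Since \<open>n\<close> is a number, an \<open>n \<times> n\<close> matrix is a function on pairs of
  indices that vanishes outside \<open>{1..n} \<times> {1..n}\<close>.
\<close>

type_synonym cmat = "nat \<Rightarrow> nat \<Rightarrow> complex"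

definition gl :: "nat \<Rightarrow> cmat set" where
  "gl n = {A. \<forall>i k. A i k \<noteq> 0 \<longrightarrow> i \<in> {1..n} \<and> k \<in> {1..n}}"

definition mat_prod :: "nat \<Rightarrow> cmat \<Rightarrow> cmat \<Rightarrow> cmat" where
  "mat_prod n A B = (\<lambda>i k. \<Sum>l=1..n. A i l * B l k)"

definition mat_comm :: "nat \<Rightarrow> cmat \<Rightarrow> cmat \<Rightarrow> cmat" where
  "mat_comm n A B = mat_prod n A B - mat_prod n B A"

definition mat_unit :: "nat \<Rightarrow> nat \<Rightarrow> cmat" where
  "mat_unit i k = (\<lambda>p q. if p = i \<and> q = k then 1 else 0)"

text \<open>
  An element \<open>\<Sum>\<^sub>m X\<^sub>m \<otimes> t\<^sup>m\<close> of \<open>gl\<^sub>n \<otimes> \<complex>[t, t\<^sup>-\<^sup>1]\<close> is the finitely supported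
  function \<open>m \<mapsto> X\<^sub>m\<close>; \<open>loop_elt x m\<close> is \<open>x(m) = x \<otimes> t\<^sup>m\<close>.
\<close>

type_synonym loop = "int \<Rightarrow> cmat"

definition loop_elt :: "cmat \<Rightarrow> int \<Rightarrow> loop" where
  "loop_elt x m = (\<lambda>p. if p = m then x else 0)"

definition loop_scale :: "complex \<Rightarrow> loop \<Rightarrow> loop" where
  "loop_scale c X = (\<lambda>m i k. c * X m i k)"

definition loop_bracket :: "nat \<Rightarrow> loop \<Rightarrow> loop \<Rightarrow> loop" where
  "loop_bracket n X Y = (\<lambda>p. \<Sum>m | X m \<noteq> 0. mat_comm n (X m) (Y (p - m)))"

definition loop_gl :: "nat \<Rightarrow> loop lie_alg" where
  "loop_gl n =
    \<lparr>lcarrier = {X. finite {m. X m \<noteq> 0} \<and> (\<forall>m. X m \<in> gl n)},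
     ladd = (+), lzero = 0, lscale = loop_scale, lbracket = loop_bracket n\<rparr>"

section \<open>Exterior algebras\<close>

text \<open>
  An element of the exterior algebra on a finite, linearly ordered set \<open>I\<close> of variables
  is given by its coefficients: the set \<open>S = {s\<^sub>1 < \<dots> < s\<^sub>p} \<subseteq> I\<close> stands for
  the monomial \<open>s\<^sub>1 \<cdots> s\<^sub>p\<close>.  If \<open>S\<close> and \<open>T\<close> are disjoint, the product
  of their monomials is \<open>ext_sign S T\<close> times the monomial of \<open>S \<union> T\<close>; otherwise it is zero.
\<close>

type_synonym 'a ext = "'a set \<Rightarrow> complex"

definition ext_alg :: "'a set \<Rightarrow> 'a ext set" where
  "ext_alg I = {v. \<forall>S. v S \<noteq> 0 \<longrightarrow> S \<subseteq> I}"

definition ext_sign :: "'a::linorder set \<Rightarrow> 'a set \<Rightarrow> complex" where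
  "ext_sign S T = (- 1) ^ card {(s, t). s \<in> S \<and> t \<in> T \<and> t < s}"

definition ext_mult :: "'a::linorder ext \<Rightarrow> 'a ext \<Rightarrow> 'a ext" (infixl "\<odot>" 70) where
  "v \<odot> w = (\<lambda>U. \<Sum>S\<in>Pow U. ext_sign S (U - S) * v S * w (U - S))"

definition ext_scale :: "complex \<Rightarrow> 'a ext \<Rightarrow> 'a ext" where
  "ext_scale c v = (\<lambda>S. c * v S)"

definition ext_mono :: "'a set \<Rightarrow> 'a ext" where
  "ext_mono T = (\<lambda>S. if S = T then 1 else 0)"

abbreviation ext_gen :: "'a \<Rightarrow> 'a ext" where
  "ext_gen a \<equiv> ext_mono {a}"

definition parity :: "'a ext \<Rightarrow> 'a ext" where
  "parity v = (\<lambda>S. (- 1) ^ card S * v S)"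

text \<open>
  Endomorphisms of a space \<open>V\<close> are extensional functions (as in \<open>HOL-Library.FuncSet\<close>), so that
  they are equal as soon as they agree on \<open>V\<close>.
\<close>

definition ext_End :: "'a ext set \<Rightarrow> ('a ext \<Rightarrow> 'a ext) set" where
  "ext_End V = {f \<in> V \<rightarrow>\<^sub>E V. (\<forall>v\<in>V. \<forall>w\<in>V. f (v + w) = f v + f w) \<and>
      (\<forall>c. \<forall>v\<in>V. f (ext_scale c v) = ext_scale c (f v))}"

definition End_lie :: "'a ext set \<Rightarrow> ('a ext \<Rightarrow> 'a ext) lie_alg" where
  "End_lie V =
    \<lparr>lcarrier = ext_End V,
     ladd = (\<lambda>f g. \<lambda>v\<in>V. f v + g v),
     lzero = (\<lambda>v\<in>V. 0),
     lscale = (\<lambda>c f. \<lambda>v\<in>V. ext_scale c (f v)),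
     lbracket = (\<lambda>f g. \<lambda>v\<in>V. f (g v) - g (f v))\<rparr>"

text \<open>
  The Leibniz rule of an odd left derivation: \<open>D(vw) = D(v) w + (- 1)\<^sup>p v D(w)\<close> for \<open>v\<close> of
  degree \<open>p\<close>.
\<close>

definition odd_derivation :: "'a::linorder set \<Rightarrow> ('a ext \<Rightarrow> 'a ext) \<Rightarrow> bool" where
  "odd_derivation I D \<longleftrightarrow> D \<in> ext_End (ext_alg I) \<and>
    (\<forall>v\<in>ext_alg I. \<forall>w\<in>ext_alg I. D (v \<odot> w) = D v \<odot> w + parity v \<odot> D w)"

section \<open>The space \<open>V\<^sub>n\<^sub>,\<^sub>r\<close> and the map \<open>\<psi>\<close>\<close>

definition vars :: "nat \<Rightarrow> nat \<Rightarrow> (nat \<times> nat) set" where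
  "vars n r = {1..n} \<times> {..<r}"

abbreviation ext_V :: "nat \<Rightarrow> nat \<Rightarrow> (nat \<times> nat) ext set" where
  "ext_V n r \<equiv> ext_alg (vars n r)"

definition y_var :: "nat \<Rightarrow> nat \<Rightarrow> (nat \<times> nat) ext" where
  "y_var i j = ext_gen (i, j)"

definition x_var :: "nat \<Rightarrow> nat \<Rightarrow> nat \<Rightarrow> (nat \<times> nat) ext" where
  "x_var r i j = (\<Sum>k\<le>j. ext_scale (of_nat (j choose k)) (y_var i (r - 1 - k)))"

text \<open>
  \<open>\<partial>/\<partial>x\<^sub>k\<^sub>,\<^sub>s\<close> is the odd left derivation sending \<open>x\<^sub>k\<^sub>,\<^sub>s\<close> to \<open>1\<close> and the other \<open>x\<^sub>i\<^sub>,\<^sub>j\<close> to \<open>0\<close>;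
  see \<open>partial_x_ex1\<close> below.
\<close>

definition is_partial_x :: "nat \<Rightarrow> nat \<Rightarrow> nat \<Rightarrow> nat \<Rightarrow> ((nat \<times> nat) ext \<Rightarrow> (nat \<times> nat) ext) \<Rightarrow> bool" where
  "is_partial_x n r k s D \<longleftrightarrow> odd_derivation (vars n r) D \<and>
    (\<forall>i\<in>{1..n}. \<forall>j<r. D (x_var r i j) = (if i = k \<and> j = s then ext_mono {} else 0))"

definition partial_x :: "nat \<Rightarrow> nat \<Rightarrow> nat \<Rightarrow> nat \<Rightarrow> (nat \<times> nat) ext \<Rightarrow> (nat \<times> nat) ext" where
  "partial_x n r k s = (THE D. is_partial_x n r k s D)"

definition lagrange :: "nat \<Rightarrow> nat \<Rightarrow> complex \<Rightarrow> complex" where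
  "lagrange j r t = (\<Prod>i\<in>{..<r} - {j}. (t - of_nat i) / (of_nat j - of_nat i))"

definition psi_unit ::
  "complex \<Rightarrow> nat \<Rightarrow> nat \<Rightarrow> nat \<Rightarrow> nat \<Rightarrow> int \<Rightarrow> (nat \<times> nat) ext \<Rightarrow> (nat \<times> nat) ext" where
  "psi_unit a n r i k m = (\<lambda>v\<in>ext_V n r. ext_scale (a powi m)
    (\<Sum>j<r. \<Sum>s<r. ext_scale (lagrange j r (of_int m + of_nat s)) (x_var r i j \<odot> partial_x n r k s v)))"

text \<open>
  The linear extension of \<open>E\<^sub>i\<^sub>k(m) \<mapsto> psi_unit a n r i k m\<close> to
  \<open>X = \<Sum>\<^sub>m \<Sum>\<^sub>i\<^sub>,\<^sub>k (X\<^sub>m)\<^sub>i\<^sub>k E\<^sub>i\<^sub>k(m)\<close>.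
\<close>

definition psi :: "complex \<Rightarrow> nat \<Rightarrow> nat \<Rightarrow> loop \<Rightarrow> (nat \<times> nat) ext \<Rightarrow> (nat \<times> nat) ext" where
  "psi a n r X = (\<lambda>v\<in>ext_V n r. \<Sum>m | X m \<noteq> 0. \<Sum>i=1..n. \<Sum>k=1..n.
    ext_scale (X m i k) (psi_unit a n r i k m v))"

section \<open>Well-definedness\<close>

lemma sum_fun_apply: "(\<Sum>i\<in>A. f i) x = (\<Sum>i\<in>A. f i x)"
  by (induction A rule: infinite_finite_induct) auto

lemma psi_mat_unit:
  assumes "i \<in> {1..n}" "k \<in> {1..n}"
  shows "psi a n r (loop_elt (mat_unit i k) m) = psi_unit a n r i k m"
proof -
  have nz: "mat_unit i k \<noteq> 0"
    by (metis mat_unit_def zero_fun_apply zero_neq_one)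
  then have supp: "{p. loop_elt (mat_unit i k) m p \<noteq> 0} = {m}"
    by (auto simp: loop_elt_def)
  have *: "(\<Sum>i'=1..n. \<Sum>k'=1..n. ext_scale (mat_unit i k i' k') (F i' k')) = F i k"
    for F :: "nat \<Rightarrow> nat \<Rightarrow> (nat \<times> nat) ext"
  proof -
    have "(\<Sum>i'=1..n. \<Sum>k'=1..n. ext_scale (mat_unit i k i' k') (F i' k'))
      = (\<Sum>i'=1..n. \<Sum>k'=1..n. if k' = k then if i' = i then F i' k' else 0 else 0)"
      by (intro sum.cong refl) (auto simp: mat_unit_def ext_scale_def fun_eq_iff)
    also have "\<dots> = F i k"
      using assms by (simp add: sum.delta)
    finally show ?thesis .
  qed
  show ?thesis
    unfolding psi_def supp by (rule ext) (simp add: loop_elt_def * psi_unit_def del: One_nat_def)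
qed

subsection \<open>The two Lie algebras\<close>

lemma complex_lie_algebra_End: "complex_lie_algebra (End_lie (ext_alg I))"
proof -
  define V where "V = ext_alg I"
  have V_iff: "v \<in> V \<longleftrightarrow> (\<forall>S. \<not> S \<subseteq> I \<longrightarrow> v S = 0)" for v
    by (auto simp: V_def ext_alg_def)
  have Vadd: "v + w \<in> V" and Vscale: "ext_scale c v \<in> V"
    and Vneg: "- v \<in> V" and Vdiff: "v - w \<in> V" if "v \<in> V" "w \<in> V" for v w c
    using that unfolding V_iff ext_scale_def by auto
  have V0: "0 \<in> V"
    by (auto simp: V_def ext_alg_def)
  have E: "f v \<in> V" "f (v + w) = f v + f w" "f (ext_scale c v) = ext_scale c (f v)"
    "f (- v) = - f v" "f (v - w) = f v - f w"
    if "f \<in> ext_End V" "v \<in> V" "w \<in> V" for f v w c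
  proof -
    show 1: "f v \<in> V" and 2: "f (v + w) = f v + f w"
      and 3: "f (ext_scale c v) = ext_scale c (f v)"
      using that by (auto simp: ext_End_def)
    have 4: "f (- w) = - f w" if "w \<in> V" for w
    proof -
      have "f (ext_scale (- 1) w) = ext_scale (- 1) (f w)"
        using that \<open>f \<in> ext_End V\<close> by (auto simp: ext_End_def)
      moreover have "ext_scale (- 1) u = - u" for u :: "'a ext"
        by (auto simp: ext_scale_def fun_eq_iff)
      ultimately show ?thesis by simp
    qed
    then show "f (- v) = - f v" using that by simp
    have "\<forall>v\<in>V. \<forall>w\<in>V. f (v + w) = f v + f w"
      using \<open>f \<in> ext_End V\<close> by (auto simp: ext_End_def)
    then have "f (v + - w) = f v + f (- w)"
      using that Vneg by blast
    then show "f (v - w) = f v - f w"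
      using 4 that by simp
  qed
  have EI: "(\<lambda>v\<in>V. F v) \<in> ext_End V"
    if "\<And>v. v \<in> V \<Longrightarrow> F v \<in> V" "\<And>v w. v \<in> V \<Longrightarrow> w \<in> V \<Longrightarrow> F (v + w) = F v + F w"
      "\<And>c v. v \<in> V \<Longrightarrow> F (ext_scale c v) = ext_scale c (F v)" for F
    using that by (auto simp: ext_End_def Vadd Vscale)
  have s_add: "ext_scale c (v + w) = ext_scale c v + ext_scale c w"
    and s_diff: "ext_scale c (v - w) = ext_scale c v - ext_scale c w"
    and s_left: "ext_scale (c + d) v = ext_scale c v + ext_scale d v"
    and s_s: "ext_scale c (ext_scale d v) = ext_scale (c * d) v"
    and s_1: "ext_scale 1 v = v" and s_0: "ext_scale c 0 = 0" for c d and v w :: "'a ext"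
    by (auto simp: ext_scale_def fun_eq_iff algebra_simps)
  have eqI: "f = g" if "f \<in> ext_End V" "g \<in> ext_End V" "\<And>v. v \<in> V \<Longrightarrow> f v = g v" for f g
    by (rule PiE_ext[of f V "\<lambda>_. V" g]) (use that in \<open>auto simp: ext_End_def\<close>)
  define ad sc br and ze :: "'a ext \<Rightarrow> 'a ext"
    where "ad = (\<lambda>f g. \<lambda>v\<in>V. (f v + g v :: 'a ext))"
      and "sc = (\<lambda>c f. \<lambda>v\<in>V. (ext_scale c (f v) :: 'a ext))"
      and "br = (\<lambda>f g. \<lambda>v\<in>V. (f (g v) - g (f v) :: 'a ext))"
      and "ze = (\<lambda>v\<in>V. 0)"
  note defs = ad_def sc_def br_def ze_def
  have sel: "lcarrier (End_lie V) = ext_End V" "ladd (End_lie V) = ad" "lzero (End_lie V) = ze"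
    "lscale (End_lie V) = sc" "lbracket (End_lie V) = br"
    by (simp_all add: End_lie_def defs)
  have app: "ad f g v = f v + g v" "ze v = 0" "sc c f v = ext_scale c (f v)"
    "br f g v = f (g v) - g (f v)" if "v \<in> V" for f g v c
    using that by (simp_all add: defs)
  have cl_add: "ad f g \<in> ext_End V" if "f \<in> ext_End V" "g \<in> ext_End V" for f g
    unfolding defs by (rule EI) (use that in \<open>auto simp: E Vadd s_add\<close>)
  have cl_zero: "ze \<in> ext_End V"
    unfolding defs by (rule EI) (auto simp: V0 s_0)
  have cl_scale: "sc c f \<in> ext_End V" if "f \<in> ext_End V" for f c
    unfolding defs by (rule EI) (simp_all only: that E Vscale s_add s_s mult.commute)
  have cl_br: "br f g \<in> ext_End V" if "f \<in> ext_End V" "g \<in> ext_End V" for f g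
    unfolding defs by (rule EI) (simp_all only: that E Vdiff s_diff add_diff_add)
  note cl = cl_add cl_zero cl_scale cl_br
  have neg: "ad f (sc (- 1) f) = ze" if "f \<in> ext_End V" for f
  proof (rule eqI)
    show "ad f (sc (- 1) f) v = ze v" if "v \<in> V" for v
      using that by (auto simp: app ext_scale_def fun_eq_iff)
  qed (simp_all add: cl that)
  then have ex: "\<exists>g\<in>ext_End V. ad f g = ze" if "f \<in> ext_End V" for f
    using cl_scale that by blast
  have "complex_lie_algebra (End_lie V)"
    unfolding complex_lie_algebra_def sel
    by (intro conjI allI impI; (rule eqI)?)
      (auto simp: cl app E s_add s_diff s_left s_s s_1 Vadd Vscale Vdiff mult.commute ex)
  then show ?thesis by (simp add: V_def)
qed

lemma mat_comm_zero: "mat_comm n x 0 = 0" "mat_comm n 0 x = 0"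
  by (auto simp: mat_comm_def mat_prod_def fun_eq_iff)

lemma loop_bracket_eq1:
  assumes "finite A" "{m. X m \<noteq> 0} \<subseteq> A"
  shows "loop_bracket n X Y p = (\<Sum>m\<in>A. mat_comm n (X m) (Y (p - m)))"
  unfolding loop_bracket_def
  by (rule sum.mono_neutral_left) (use assms mat_comm_zero in auto)

lemma loop_bracket_eq:
  assumes "finite A" "finite B" "{m. X m \<noteq> 0} \<subseteq> A" "{m. Y m \<noteq> 0} \<subseteq> B"
  shows "loop_bracket n X Y p = (\<Sum>m\<in>A. \<Sum>k\<in>B. if p = m + k then mat_comm n (X m) (Y k) else 0)"
proof -
  have "(\<Sum>k\<in>B. if p = m + k then mat_comm n (X m) (Y k) else 0)
      = mat_comm n (X m) (Y (p - m))" for m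
  proof -
    have "(\<Sum>k\<in>B. if p = m + k then mat_comm n (X m) (Y k) else 0)
        = (\<Sum>k\<in>B. if k = p - m then mat_comm n (X m) (Y k) else 0)"
      by (intro sum.cong) auto
    also have "\<dots> = (if p - m \<in> B then mat_comm n (X m) (Y (p - m)) else 0)"
      using assms by simp
    also have "\<dots> = mat_comm n (X m) (Y (p - m))"
      using assms mat_comm_zero by (smt (verit) mem_Collect_eq subsetD)
    finally show ?thesis .
  qed
  then show ?thesis
    using loop_bracket_eq1[OF assms(1,3)] by simp
qed

lemma loop_bracket_loop_elt:
  "loop_bracket n (loop_elt x m) (loop_elt y k) = loop_elt (mat_comm n x y) (m + k)"
proof
  fix p
  have "loop_bracket n (loop_elt x m) (loop_elt y k) p
      = (\<Sum>m'\<in>{m}. \<Sum>k'\<in>{k}. if p = m' + k' then mat_comm n (loop_elt x m m') (loop_elt y k k') else 0)"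
    by (rule loop_bracket_eq) (auto simp: loop_elt_def)
  then show "loop_bracket n (loop_elt x m) (loop_elt y k) p = loop_elt (mat_comm n x y) (m + k) p"
    by (simp add: loop_elt_def)
qed

lemma mat_prod_assoc: "mat_prod n (mat_prod n x y) z = mat_prod n x (mat_prod n y z)"
proof (intro ext)
  fix i k
  have "mat_prod n (mat_prod n x y) z i k = (\<Sum>l=1..n. \<Sum>p=1..n. x i p * y p l * z l k)"
    by (simp add: mat_prod_def sum_distrib_right)
  also have "\<dots> = (\<Sum>p=1..n. \<Sum>l=1..n. x i p * y p l * z l k)"
    by (rule sum.swap)
  also have "\<dots> = mat_prod n x (mat_prod n y z) i k"
    by (simp add: mat_prod_def sum_distrib_left mult.assoc)
  finally show "mat_prod n (mat_prod n x y) z i k = mat_prod n x (mat_prod n y z) i k" .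
qed

lemma mat_prod_bilinear:
  "mat_prod n (x + y) z = mat_prod n x z + mat_prod n y z"
  "mat_prod n z (x + y) = mat_prod n z x + mat_prod n z y"
  "mat_prod n (x - y) z = mat_prod n x z - mat_prod n y z"
  "mat_prod n z (x - y) = mat_prod n z x - mat_prod n z y"
  by (auto simp: mat_prod_def fun_eq_iff algebra_simps sum.distrib sum_subtractf)

lemma mat_comm_add:
  "mat_comm n (x + y) z = mat_comm n x z + mat_comm n y z"
  "mat_comm n z (x + y) = mat_comm n z x + mat_comm n z y"
  by (simp_all add: mat_comm_def mat_prod_bilinear)

lemma mat_comm_scale:
  "mat_comm n (\<lambda>i k. c * x i k) z = (\<lambda>i k. c * mat_comm n x z i k)"
  "mat_comm n z (\<lambda>i k. c * x i k) = (\<lambda>i k. c * mat_comm n z x i k)"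
  by (auto simp: mat_comm_def mat_prod_def fun_eq_iff algebra_simps sum_distrib_left)

lemma mat_comm_sum: "mat_comm n x (\<Sum>i\<in>A. f i) = (\<Sum>i\<in>A. mat_comm n x (f i))"
  by (induction A rule: infinite_finite_induct)
    (simp_all only: sum.infinite sum.empty sum.insert mat_comm_zero mat_comm_add not_False_eq_True)

lemma mat_comm_anti: "mat_comm n x y = - mat_comm n y x"
  by (simp add: mat_comm_def)

lemma mat_comm_jacobi:
  "mat_comm n x (mat_comm n y z) + (mat_comm n y (mat_comm n z x) + mat_comm n z (mat_comm n x y)) = 0"
  by (simp add: mat_comm_def mat_prod_bilinear mat_prod_assoc)

lemma mat_comm_gl:
  assumes "x \<in> gl n" "y \<in> gl n" shows "mat_comm n x y \<in> gl n"
proof -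
  have gl_iff: "x \<in> gl n \<longleftrightarrow> (\<forall>i k. \<not> (i \<in> {1..n} \<and> k \<in> {1..n}) \<longrightarrow> x i k = 0)" for x
    unfolding gl_def by blast
  have "mat_prod n x y \<in> gl n" if "x \<in> gl n" "y \<in> gl n" for x y
    using that unfolding gl_def mat_prod_def
    by (smt (verit, best) mem_Collect_eq mult_eq_0_iff sum.neutral)
  then have *: "mat_prod n x y \<in> gl n" "mat_prod n y x \<in> gl n" using assms by auto
  then show ?thesis
    unfolding gl_iff mat_comm_def by simp
qed

lemma gl_sum: "(\<And>i. i \<in> A \<Longrightarrow> f i \<in> gl n) \<Longrightarrow> (\<Sum>i\<in>A. f i) \<in> gl n"
proof -
  assume *: "\<And>i. i \<in> A \<Longrightarrow> f i \<in> gl n"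
  have "(\<Sum>j\<in>A. f j) i k = 0" if "\<not> (i \<in> {1..n} \<and> k \<in> {1..n})" for i k
  proof -
    have "f j i k = 0" if "j \<in> A" for j
      using *[OF that] \<open>\<not> _\<close> unfolding gl_def by blast
    then show ?thesis by (simp add: sum_fun_apply)
  qed
  then show ?thesis unfolding gl_def by blast
qed

lemma loop_bracket_triple:
  assumes "finite A" "{m. X m \<noteq> 0} \<subseteq> A" "{m. Y m \<noteq> 0} \<subseteq> A" "{m. Z m \<noteq> 0} \<subseteq> A"
  shows "loop_bracket n X (loop_bracket n Y Z) p = (\<Sum>m\<in>A. \<Sum>q\<in>A. \<Sum>l\<in>A.
    if p = m + q + l then mat_comm n (X m) (mat_comm n (Y q) (Z l)) else 0)"
  unfolding loop_bracket_eq1[OF assms(1,2)] loop_bracket_eq[OF assms(1,1,3,4)] mat_comm_sum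
  by (intro sum.cong) (auto simp: mat_comm_zero)

lemma complex_lie_algebra_loop_gl: "complex_lie_algebra (loop_gl n)"
proof -
  have loop_scale_supp: "{m. loop_scale c X m \<noteq> 0} \<subseteq> {m. X m \<noteq> 0}" for c X
    by (auto simp: loop_scale_def fun_eq_iff)
  have fin_add: "finite {m. (X + Y) m \<noteq> 0}" if "finite {m. X m \<noteq> 0}" "finite {m. Y m \<noteq> 0}"
    for X Y :: loop
    by (rule finite_subset[OF _ finite_UnI[OF that]]) auto
  have gl_iff: "x \<in> gl n \<longleftrightarrow> (\<forall>i k. \<not> (i \<in> {1..n} \<and> k \<in> {1..n}) \<longrightarrow> x i k = 0)" for x
    unfolding gl_def by blast
  have gl_add: "x + y \<in> gl n" if "x \<in> gl n" "y \<in> gl n" for x y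
    using that unfolding gl_iff by simp
  have add_left: "loop_bracket n (X + Y) Z = loop_bracket n X Z + loop_bracket n Y Z"
    and add_right: "loop_bracket n Z (X + Y) = loop_bracket n Z X + loop_bracket n Z Y"
    and scale_left: "loop_bracket n (loop_scale c X) Z = loop_scale c (loop_bracket n X Z)"
    and scale_right: "loop_bracket n Z (loop_scale c X) = loop_scale c (loop_bracket n Z X)"
    if fin: "finite {m. X m \<noteq> 0}" "finite {m. Y m \<noteq> 0}" "finite {m. Z m \<noteq> 0}" for X Y Z c
  proof -
    define A where "A = {m. X m \<noteq> 0} \<union> {m. Y m \<noteq> 0} \<union> {m. Z m \<noteq> 0}"
    have A: "finite A" using fin by (simp add: A_def)
    have e: "loop_bracket n W U p = (\<Sum>m\<in>A. mat_comm n (W m) (U (p - m)))"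
      if "{m. W m \<noteq> 0} \<subseteq> A" for W U p by (rule loop_bracket_eq1[OF A that])
    have s: "{m. X m \<noteq> 0} \<subseteq> A" "{m. Y m \<noteq> 0} \<subseteq> A" "{m. Z m \<noteq> 0} \<subseteq> A"
      "{m. (X + Y) m \<noteq> 0} \<subseteq> A" "{m. loop_scale c X m \<noteq> 0} \<subseteq> A"
      using loop_scale_supp[of c X] by (auto simp: A_def)
    show "loop_bracket n (X + Y) Z = loop_bracket n X Z + loop_bracket n Y Z"
      "loop_bracket n Z (X + Y) = loop_bracket n Z X + loop_bracket n Z Y"
      by (rule ext, simp add: e s[simplified] mat_comm_add sum.distrib)+
    show "loop_bracket n (loop_scale c X) Z = loop_scale c (loop_bracket n X Z)"
      "loop_bracket n Z (loop_scale c X) = loop_scale c (loop_bracket n Z X)"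
      unfolding fun_eq_iff loop_scale_def[of c "loop_bracket _ _ _"] e[OF s(1)] e[OF s(3)] e[OF s(5)]
      by (simp_all add: loop_scale_def mat_comm_scale sum_fun_apply sum_distrib_left)
  qed
  have fin_br: "finite {m. loop_bracket n X Y m \<noteq> 0}"
    if fin: "finite {m. X m \<noteq> 0}" "finite {m. Y m \<noteq> 0}" for X Y
  proof (rule finite_subset)
    show "{m. loop_bracket n X Y m \<noteq> 0} \<subseteq> (\<lambda>(m, k). m + k) ` ({m. X m \<noteq> 0} \<times> {m. Y m \<noteq> 0})"
    proof
      fix p assume "p \<in> {m. loop_bracket n X Y m \<noteq> 0}"
      then have "(\<Sum>m | X m \<noteq> 0. mat_comm n (X m) (Y (p - m))) \<noteq> 0"
        by (simp add: loop_bracket_def)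
      then obtain m where "X m \<noteq> 0" "mat_comm n (X m) (Y (p - m)) \<noteq> 0"
        by (rule sum.not_neutral_contains_not_neutral) simp
      then have "X m \<noteq> 0" "Y (p - m) \<noteq> 0" by (auto simp: mat_comm_zero)
      then show "p \<in> (\<lambda>(m, k). m + k) ` ({m. X m \<noteq> 0} \<times> {m. Y m \<noteq> 0})"
        by (auto intro!: image_eqI[of _ _ "(m, p - m)"])
    qed
  qed (use fin in auto)
  have br_gl: "loop_bracket n X Y m \<in> gl n" if "\<forall>m. X m \<in> gl n" "\<forall>m. Y m \<in> gl n" for X Y m
    unfolding loop_bracket_def using that by (auto intro!: gl_sum mat_comm_gl)
  have jacobi: "loop_bracket n X (loop_bracket n Y Z)
      + (loop_bracket n Y (loop_bracket n Z X) + loop_bracket n Z (loop_bracket n X Y)) = 0"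
    if fin: "finite {m. X m \<noteq> 0}" "finite {m. Y m \<noteq> 0}" "finite {m. Z m \<noteq> 0}" for X Y Z
  proof
    fix p
    define A where "A = {m. X m \<noteq> 0} \<union> {m. Y m \<noteq> 0} \<union> {m. Z m \<noteq> 0}"
    have A: "finite A" using fin by (simp add: A_def)
    have s: "{m. X m \<noteq> 0} \<subseteq> A" "{m. Y m \<noteq> 0} \<subseteq> A" "{m. Z m \<noteq> 0} \<subseteq> A"
      by (auto simp: A_def)
    have 1: "loop_bracket n X (loop_bracket n Y Z) p = (\<Sum>m\<in>A. \<Sum>q\<in>A. \<Sum>l\<in>A.
        if p = m + q + l then mat_comm n (X m) (mat_comm n (Y q) (Z l)) else 0)"
      by (rule loop_bracket_triple[OF A s])
    have "loop_bracket n Y (loop_bracket n Z X) p = (\<Sum>q\<in>A. \<Sum>l\<in>A. \<Sum>m\<in>A.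
        if p = q + l + m then mat_comm n (Y q) (mat_comm n (Z l) (X m)) else 0)"
      by (rule loop_bracket_triple[OF A s(2,3,1)])
    also have "\<dots> = (\<Sum>q\<in>A. \<Sum>m\<in>A. \<Sum>l\<in>A.
        if p = q + l + m then mat_comm n (Y q) (mat_comm n (Z l) (X m)) else 0)"
      by (intro sum.cong refl sum.swap)
    also have "\<dots> = (\<Sum>m\<in>A. \<Sum>q\<in>A. \<Sum>l\<in>A.
        if p = q + l + m then mat_comm n (Y q) (mat_comm n (Z l) (X m)) else 0)"
      by (rule sum.swap)
    finally have 2: "loop_bracket n Y (loop_bracket n Z X) p = \<dots>" .
    have "loop_bracket n Z (loop_bracket n X Y) p = (\<Sum>l\<in>A. \<Sum>m\<in>A. \<Sum>q\<in>A.
        if p = l + m + q then mat_comm n (Z l) (mat_comm n (X m) (Y q)) else 0)"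
      by (rule loop_bracket_triple[OF A s(3,1,2)])
    also have "\<dots> = (\<Sum>m\<in>A. \<Sum>l\<in>A. \<Sum>q\<in>A.
        if p = l + m + q then mat_comm n (Z l) (mat_comm n (X m) (Y q)) else 0)"
      by (rule sum.swap)
    also have "\<dots> = (\<Sum>m\<in>A. \<Sum>q\<in>A. \<Sum>l\<in>A.
        if p = l + m + q then mat_comm n (Z l) (mat_comm n (X m) (Y q)) else 0)"
      by (intro sum.cong refl sum.swap)
    finally have 3: "loop_bracket n Z (loop_bracket n X Y) p = \<dots>" .
    have "loop_bracket n X (loop_bracket n Y Z) p
      + (loop_bracket n Y (loop_bracket n Z X) p + loop_bracket n Z (loop_bracket n X Y) p) = 0"
      unfolding 1 2 3 sum.distrib[symmetric]
    proof (intro sum.neutral ballI)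
      fix m q l
      have "p = q + l + m \<longleftrightarrow> p = m + q + l" "p = l + m + q \<longleftrightarrow> p = m + q + l"
        by auto
      then show "(if p = m + q + l then mat_comm n (X m) (mat_comm n (Y q) (Z l)) else 0)
          + ((if p = q + l + m then mat_comm n (Y q) (mat_comm n (Z l) (X m)) else 0)
          + (if p = l + m + q then mat_comm n (Z l) (mat_comm n (X m) (Y q)) else 0)) = 0"
        using mat_comm_jacobi[of n "X m" "Y q" "Z l"] by (cases "p = m + q + l") (simp_all only: if_True if_False add_0 simp_thms)
    qed
    then show "(loop_bracket n X (loop_bracket n Y Z)
      + (loop_bracket n Y (loop_bracket n Z X) + loop_bracket n Z (loop_bracket n X Y))) p = 0 p"
      by simp
  qed
  have self: "loop_bracket n X X = 0" if fin: "finite {m. X m \<noteq> 0}" for X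
  proof
    fix p
    define b where "b = loop_bracket n X X p"
    have "b = (\<Sum>m | X m \<noteq> 0. \<Sum>k | X k \<noteq> 0. if p = m + k then mat_comm n (X m) (X k) else 0)"
      unfolding b_def by (rule loop_bracket_eq) (use fin in auto)
    also have "\<dots> = (\<Sum>m | X m \<noteq> 0. \<Sum>k | X k \<noteq> 0. if p = k + m then mat_comm n (X k) (X m) else 0)"
      by (rule sum.swap)
    also have "\<dots> = (\<Sum>m | X m \<noteq> 0. \<Sum>k | X k \<noteq> 0. - (if p = m + k then mat_comm n (X m) (X k) else 0))"
    proof (intro sum.cong refl)
      fix m k
      show "(if p = k + m then mat_comm n (X k) (X m) else 0)
          = - (if p = m + k then mat_comm n (X m) (X k) else 0)"
        using mat_comm_anti[of n "X k" "X m"] by (cases "p = m + k") (simp_all add: add.commute)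
    qed
    also have "\<dots> = - b"
      unfolding b_def sum_negf by (subst loop_bracket_eq) (use fin in auto)
    finally have "b = - b" .
    then have "b i k = - b i k" for i k
      by (metis uminus_apply)
    then have "b i k = 0" for i k
      using \<open>\<And>i k. b i k = - b i k\<close>[of i k] by (simp add: complex_eq_iff)
    then show "loop_bracket n X X p = 0 p"
      by (auto simp: b_def fun_eq_iff)
  qed
  define C :: "loop set" where "C = {X. finite {m. X m \<noteq> 0} \<and> (\<forall>m. X m \<in> gl n)}"
  have sel: "lcarrier (loop_gl n) = C" "ladd (loop_gl n) = (+)" "lzero (loop_gl n) = 0"
    "lscale (loop_gl n) = loop_scale" "lbracket (loop_gl n) = loop_bracket n"
    by (simp_all add: loop_gl_def C_def)
  have fin: "finite {m. X m \<noteq> 0}" if "X \<in> C" for X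
    using that by (simp add: C_def)
  have C_add: "X + Y \<in> C" if "X \<in> C" "Y \<in> C" for X Y
    using that fin_add[of X Y] by (simp add: C_def gl_add)
  have C_zero: "0 \<in> C"
    by (simp add: C_def gl_def)
  have C_scale: "loop_scale c X \<in> C" if "X \<in> C" for c X
    using that finite_subset[OF loop_scale_supp[of c X]] by (auto simp: C_def gl_def loop_scale_def)
  have C_br: "loop_bracket n X Y \<in> C" if "X \<in> C" "Y \<in> C" for X Y
    using that by (simp add: C_def fin_br br_gl)
  have ex: "\<exists>Y\<in>C. X + Y = 0" if "X \<in> C" for X
  proof -
    have "X + loop_scale (- 1) X = 0"
      by (simp add: loop_scale_def fun_eq_iff)
    with C_scale[OF that] show ?thesis by blast
  qed
  have scale_left': "loop_bracket n (loop_scale c X) Z = loop_scale c (loop_bracket n X Z)"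
    and scale_right': "loop_bracket n Z (loop_scale c X) = loop_scale c (loop_bracket n Z X)"
    if "X \<in> C" "Z \<in> C" for X Z c
    using scale_left[of X X Z c] scale_right[of X X Z c] fin that by simp_all
  have s: "loop_scale 1 X = X" "loop_scale c (loop_scale d X) = loop_scale (c * d) X"
    "loop_scale (c + d) X = loop_scale c X + loop_scale d X"
    "loop_scale c (X + Y) = loop_scale c X + loop_scale c Y" for c d X Y
    by (auto simp: loop_scale_def fun_eq_iff algebra_simps)
  show ?thesis
    unfolding complex_lie_algebra_def sel
    by (intro conjI allI impI)
      (simp_all only: C_add C_zero C_scale C_br ex s fin add_left add_right add_0
        scale_left' scale_right' self jacobi add_ac add_0_right)
qed

subsection \<open>The exterior product\<close>

lemma ext_sign_Un_left:
  assumes "finite S" "finite S'" "finite T" "S \<inter> S' = {}"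
  shows "ext_sign (S \<union> S') T = ext_sign S T * ext_sign S' T"
proof -
  have fin: "finite {(s, t). s \<in> A \<and> t \<in> T \<and> t < s}" if "finite A" for A
    by (rule finite_subset[of _ "A \<times> T"]) (use assms that in auto)
  have "{(s, t). s \<in> S \<union> S' \<and> t \<in> T \<and> t < s}
      = {(s, t). s \<in> S \<and> t \<in> T \<and> t < s} \<union> {(s, t). s \<in> S' \<and> t \<in> T \<and> t < s}"
    by auto
  moreover have "card \<dots> = card {(s, t). s \<in> S \<and> t \<in> T \<and> t < s} + card {(s, t). s \<in> S' \<and> t \<in> T \<and> t < s}"
    by (rule card_Un_disjoint) (use assms fin in auto)
  ultimately show ?thesis by (simp add: ext_sign_def power_add)
qed

lemma ext_sign_Un_right:
  assumes "finite S" "finite T" "finite T'" "T \<inter> T' = {}"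
  shows "ext_sign S (T \<union> T') = ext_sign S T * ext_sign S T'"
proof -
  have fin: "finite {(s, t). s \<in> S \<and> t \<in> A \<and> t < s}" if "finite A" for A
    by (rule finite_subset[of _ "S \<times> A"]) (use assms that in auto)
  have "{(s, t). s \<in> S \<and> t \<in> T \<union> T' \<and> t < s}
      = {(s, t). s \<in> S \<and> t \<in> T \<and> t < s} \<union> {(s, t). s \<in> S \<and> t \<in> T' \<and> t < s}"
    by auto
  moreover have "card \<dots> = card {(s, t). s \<in> S \<and> t \<in> T \<and> t < s} + card {(s, t). s \<in> S \<and> t \<in> T' \<and> t < s}"
    by (rule card_Un_disjoint) (use assms fin in auto)
  ultimately show ?thesis by (simp add: ext_sign_def power_add)
qed

lemma ext_sign_insert:
  assumes "finite S" "finite T"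
  shows "a \<notin> S \<Longrightarrow> ext_sign (insert a S) T = ext_sign {a} T * ext_sign S T"
    and "a \<notin> T \<Longrightarrow> ext_sign S (insert a T) = ext_sign S {a} * ext_sign S T"
  using ext_sign_Un_left[of "{a}" S T] ext_sign_Un_right[of S "{a}" T] assms by simp_all

lemma ext_sign_empty [simp]: "ext_sign {} T = 1" "ext_sign S {} = 1"
  by (simp_all add: ext_sign_def)

lemma ext_sign_single: "ext_sign {a} {b} = (if b < a then - 1 else 1)"
proof -
  have "{(s, t). s \<in> {a} \<and> t \<in> {b} \<and> t < s} = (if b < a then {(a, b)} else {})"
    by auto
  then show ?thesis by (simp add: ext_sign_def)
qed

lemma ext_sign_sq [simp]: "ext_sign S T * ext_sign S T = 1"
  by (simp add: ext_sign_def flip: power_add)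

lemma ext_sign_swap:
  assumes "finite T" "a \<notin> T"
  shows "ext_sign {a} T * ext_sign T {a} = (- 1) ^ card T"
  using assms
proof (induction T)
  case (insert x T)
  have "ext_sign {a} (insert x T) * ext_sign (insert x T) {a}
      = (ext_sign {a} {x} * ext_sign {x} {a}) * (ext_sign {a} T * ext_sign T {a})"
    using ext_sign_insert[OF _ insert(1), of "{a}" x] ext_sign_insert[OF insert(1), of "{a}" x] insert
    by simp
  also have "ext_sign {a} {x} * ext_sign {x} {a} = - 1"
    using insert by (auto simp: ext_sign_single)
  finally show ?case using insert by simp
qed simp

lemma ext_mult_closed:
  assumes "v \<in> ext_alg I" "w \<in> ext_alg I" shows "v \<odot> w \<in> ext_alg I"
  unfolding ext_alg_def
proof (intro CollectI allI impI)
  fix U assume "(v \<odot> w) U \<noteq> 0"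
  then obtain S where "S \<in> Pow U" "ext_sign S (U - S) * v S * w (U - S) \<noteq> 0"
    unfolding ext_mult_def by (metis (no_types, lifting) sum.not_neutral_contains_not_neutral)
  then have "S \<subseteq> U" "S \<subseteq> I" "U - S \<subseteq> I"
    using assms by (simp_all add: ext_alg_def)
  then show "U \<subseteq> I" by blast
qed

lemma ext_mult_infinite: "infinite U \<Longrightarrow> (v \<odot> w) U = 0"
  by (simp add: ext_mult_def)

lemma ext_mult_assoc: "(u \<odot> v) \<odot> w = u \<odot> (v \<odot> w)"
proof
  fix U
  show "((u \<odot> v) \<odot> w) U = (u \<odot> (v \<odot> w)) U"
  proof (cases "finite U")
    case True
    have fin: "finite A" if "A \<subseteq> U" for A using that True by (rule finite_subset)
    have "((u \<odot> v) \<odot> w) U = (\<Sum>A\<in>Pow U. \<Sum>B\<in>Pow A.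
        ext_sign A (U - A) * (ext_sign B (A - B) * u B * v (A - B)) * w (U - A))"
      unfolding ext_mult_def by (simp add: sum_distrib_left sum_distrib_right)
    also have "\<dots> = (\<Sum>(A, B)\<in>(SIGMA A:Pow U. Pow A).
        ext_sign A (U - A) * (ext_sign B (A - B) * u B * v (A - B)) * w (U - A))"
      using True fin by (intro sum.Sigma) auto
    also have "\<dots> = (\<Sum>(B, C)\<in>(SIGMA B:Pow U. Pow (U - B)).
        ext_sign B (U - B) * u B * (ext_sign C (U - B - C) * v C * w (U - B - C)))"
    proof (rule sum.reindex_bij_witness[of _ "\<lambda>(B, C). (B \<union> C, B)" "\<lambda>(A, B). (B, A - B)"], goal_cases)
      case (5 x)
      then obtain A B where x: "x = (A, B)" "B \<subseteq> A" "A \<subseteq> U" by auto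
      define C E where "C = A - B" and "E = U - A"
      have A: "A = B \<union> C" "U - A = E" "U - B = C \<union> E" "A - B = C" "U - B - C = E"
        "C \<union> E - C = E" "B \<inter> C = {}" "C \<inter> E = {}"
        using x by (auto simp: C_def E_def)
      have f: "finite B" "finite C" "finite E"
        using x by (auto simp: C_def E_def intro!: fin)
      show ?case
        using f A(7,8) unfolding x prod.case A(4) A(5) A(2) unfolding A(1) A(3)
        by (simp add: ext_sign_Un_left ext_sign_Un_right)
    qed auto
    also have "\<dots> = (\<Sum>B\<in>Pow U. \<Sum>C\<in>Pow (U - B).
        ext_sign B (U - B) * u B * (ext_sign C (U - B - C) * v C * w (U - B - C)))"
      using True by (intro sum.Sigma[symmetric]) auto
    also have "\<dots> = (u \<odot> (v \<odot> w)) U"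
      unfolding ext_mult_def by (simp add: sum_distrib_left)
    finally show ?thesis .
  qed (simp add: ext_mult_infinite)
qed

lemma ext_gen_mult_mono:
  assumes "finite S"
  shows "ext_gen a \<odot> ext_mono S = (if a \<in> S then 0 else ext_scale (ext_sign {a} S) (ext_mono (insert a S)))"
proof
  fix U
  show "(ext_gen a \<odot> ext_mono S) U
      = (if a \<in> S then 0 else ext_scale (ext_sign {a} S) (ext_mono (insert a S))) U"
  proof (cases "finite U")
    case True
    have "(ext_gen a \<odot> ext_mono S) U
        = (\<Sum>T\<in>Pow U. if T = {a} then (if U - T = S then ext_sign T (U - T) else 0) else 0)"
      unfolding ext_mult_def by (intro sum.cong) (auto simp: ext_mono_def)
    also have "\<dots> = (if a \<in> U \<and> U - {a} = S then ext_sign {a} S else 0)"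
      using True by (auto simp: sum.delta)
    finally show ?thesis
      by (auto simp: ext_scale_def ext_mono_def)
  next
    case False
    then show ?thesis
      using assms by (auto simp: ext_mult_infinite ext_scale_def ext_mono_def)
  qed
qed

lemma ext_gen_anticommute: "ext_gen a \<odot> ext_gen b = - (ext_gen b \<odot> ext_gen a)"
  by (cases "a = b")
    (auto simp: ext_gen_mult_mono ext_sign_single ext_scale_def fun_eq_iff insert_commute)

lemma ext_mult_one:
  assumes "finite I" "v \<in> ext_alg I"
  shows "ext_mono {} \<odot> v = v" "v \<odot> ext_mono {} = v"
proof -
  have inf: "v U = 0" if "infinite U" for U
    using that assms finite_subset[of U I] by (auto simp: ext_alg_def)
  have "(ext_mono {} \<odot> v) U = v U \<and> (v \<odot> ext_mono {}) U = v U" for U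
  proof (cases "finite U")
    case True
    have "(ext_mono {} \<odot> v) U = (\<Sum>T\<in>Pow U. if T = {} then v U else 0)"
      "(v \<odot> ext_mono {}) U = (\<Sum>T\<in>Pow U. if T = U then v U else 0)"
      unfolding ext_mult_def by (intro sum.cong; auto simp: ext_mono_def)+
    then show ?thesis using True by (simp add: sum.delta)
  qed (simp add: ext_mult_infinite inf)
  then show "ext_mono {} \<odot> v = v" "v \<odot> ext_mono {} = v" by auto
qed

subsection \<open>Existence and uniqueness of the partial derivatives\<close>

lemma ext_End_simps:
  assumes "f \<in> ext_End (ext_alg I)" "v \<in> ext_alg I"
  shows "f v \<in> ext_alg I" "w \<in> ext_alg I \<Longrightarrow> f (v + w) = f v + f w"
    "f (ext_scale c v) = ext_scale c (f v)"
  using assms by (auto simp: ext_End_def)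

lemma ext_alg_closed:
  "0 \<in> ext_alg I" "v \<in> ext_alg I \<Longrightarrow> w \<in> ext_alg I \<Longrightarrow> v + w \<in> ext_alg I"
  "v \<in> ext_alg I \<Longrightarrow> ext_scale c v \<in> ext_alg I"
  "S \<subseteq> I \<Longrightarrow> ext_mono S \<in> ext_alg I"
proof -
  have iff: "v \<in> ext_alg I \<longleftrightarrow> (\<forall>S. \<not> S \<subseteq> I \<longrightarrow> v S = 0)" for v
    by (auto simp: ext_alg_def)
  show "0 \<in> ext_alg I" "v \<in> ext_alg I \<Longrightarrow> w \<in> ext_alg I \<Longrightarrow> v + w \<in> ext_alg I"
    "v \<in> ext_alg I \<Longrightarrow> ext_scale c v \<in> ext_alg I"
    "S \<subseteq> I \<Longrightarrow> ext_mono S \<in> ext_alg I"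
    by (auto simp: iff ext_scale_def ext_mono_def)
qed

lemma ext_alg_sum: "(\<And>i. i \<in> A \<Longrightarrow> F i \<in> ext_alg I) \<Longrightarrow> (\<Sum>i\<in>A. F i) \<in> ext_alg I"
  by (induction A rule: infinite_finite_induct) (auto intro: ext_alg_closed)

lemma ext_End_sum:
  assumes "f \<in> ext_End (ext_alg I)" "\<And>i. i \<in> A \<Longrightarrow> F i \<in> ext_alg I"
  shows "f (\<Sum>i\<in>A. F i) = (\<Sum>i\<in>A. f (F i))"
proof -
  have "ext_scale 0 0 = (0 :: 'a ext)" "ext_scale 0 (f 0) = 0"
    by (auto simp: ext_scale_def fun_eq_iff)
  then have f0: "f 0 = 0"
    using ext_End_simps(3)[OF assms(1) ext_alg_closed(1), of 0] by simp
  show ?thesis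
    using assms(2)
  proof (induction A rule: infinite_finite_induct)
    case (insert x A)
    have "f (F x + (\<Sum>i\<in>A. F i)) = f (F x) + f (\<Sum>i\<in>A. F i)"
      by (rule ext_End_simps(2)[OF assms(1)]) (use insert in \<open>auto intro: ext_alg_sum\<close>)
    then show ?case
      using insert by (simp only: sum.insert not_False_eq_True insertI1 insertI2)
  qed (simp_all only: sum.infinite sum.empty f0 not_False_eq_True)
qed

lemma ext_expansion:
  assumes "finite I" "v \<in> ext_alg I"
  shows "v = (\<Sum>S\<in>Pow I. ext_scale (v S) (ext_mono S))"
proof
  fix U
  have "(\<Sum>S\<in>Pow I. ext_scale (v S) (ext_mono S)) U = (\<Sum>S\<in>Pow I. if S = U then v S else 0)"
    unfolding sum_fun_apply by (intro sum.cong) (auto simp: ext_scale_def ext_mono_def)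
  also have "\<dots> = v U"
    using assms by (auto simp: sum.delta ext_alg_def)
  finally show "v U = (\<Sum>S\<in>Pow I. ext_scale (v S) (ext_mono S)) U" ..
qed

lemma odd_derivation_eqI:
  assumes I: "finite I" and D: "odd_derivation I D" and D': "odd_derivation I D'"
    and gen: "\<And>a. a \<in> I \<Longrightarrow> D (ext_gen a) = D' (ext_gen a)"
  shows "D = D'"
proof -
  have lin: "D \<in> ext_End (ext_alg I)" "D' \<in> ext_End (ext_alg I)"
    using D D' by (auto simp: odd_derivation_def)
  have one: "ext_mono {} \<in> ext_alg I"
    by (simp add: ext_alg_closed)
  have D1: "F (ext_mono {}) = 0" if F: "odd_derivation I F" for F
  proof -
    have FV: "F (ext_mono {}) \<in> ext_alg I"
      using F one by (auto simp: odd_derivation_def intro: ext_End_simps)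
    have p: "parity (ext_mono {}) = ext_mono {}"
      by (auto simp: parity_def ext_mono_def fun_eq_iff)
    have "F (ext_mono {} \<odot> ext_mono {})
        = F (ext_mono {}) \<odot> ext_mono {} + parity (ext_mono {}) \<odot> F (ext_mono {})"
      using F one unfolding odd_derivation_def by blast
    then have "F (ext_mono {}) = F (ext_mono {}) + F (ext_mono {})"
      unfolding p ext_mult_one[OF I one] ext_mult_one[OF I FV] .
    then show ?thesis by simp
  qed
  have mono: "D (ext_mono S) = D' (ext_mono S)" if "finite S" "S \<subseteq> I" for S
    using that
  proof (induction S)
    case empty
    then show ?case using D1 D D' by simp
  next
    case (insert a S)
    define e where "e = ext_sign {a} S"
    have V: "ext_gen a \<in> ext_alg I" "ext_mono S \<in> ext_alg I"
      using insert by (auto intro: ext_alg_closed)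
    have "ext_scale e (ext_gen a \<odot> ext_mono S) = ext_scale e (ext_scale e (ext_mono (insert a S)))"
      using insert by (simp add: ext_gen_mult_mono e_def)
    also have "\<dots> = ext_mono (insert a S)"
      by (simp add: ext_scale_def e_def flip: mult.assoc)
    finally have eq: "ext_mono (insert a S) = ext_scale e (ext_gen a \<odot> ext_mono S)" ..
    have "F (ext_mono (insert a S))
        = ext_scale e (F (ext_gen a) \<odot> ext_mono S + parity (ext_gen a) \<odot> F (ext_mono S))"
      if F: "odd_derivation I F" for F
    proof -
      have "F (ext_mono (insert a S)) = ext_scale e (F (ext_gen a \<odot> ext_mono S))"
        unfolding eq by (rule ext_End_simps(3)) (use F V in \<open>auto simp: odd_derivation_def ext_mult_closed\<close>)
      also have "F (ext_gen a \<odot> ext_mono S) = F (ext_gen a) \<odot> ext_mono S + parity (ext_gen a) \<odot> F (ext_mono S)"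
        using F V unfolding odd_derivation_def by blast
      finally show ?thesis .
    qed
    then show ?case
      using D D' insert gen[of a] by simp
  qed
  show ?thesis
  proof (rule PiE_ext)
    show "D \<in> ext_alg I \<rightarrow>\<^sub>E ext_alg I" "D' \<in> ext_alg I \<rightarrow>\<^sub>E ext_alg I"
      using lin by (auto simp: ext_End_def)
    fix v assume v: "v \<in> ext_alg I"
    have "F v = (\<Sum>S\<in>Pow I. ext_scale (v S) (F (ext_mono S)))" if F: "F \<in> ext_End (ext_alg I)" for F
    proof -
      have "F v = F (\<Sum>S\<in>Pow I. ext_scale (v S) (ext_mono S))"
        using ext_expansion[OF I v] by simp
      also have "\<dots> = (\<Sum>S\<in>Pow I. F (ext_scale (v S) (ext_mono S)))"
        by (rule ext_End_sum[OF F]) (auto intro: ext_alg_closed)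
      also have "\<dots> = (\<Sum>S\<in>Pow I. ext_scale (v S) (F (ext_mono S)))"
        by (intro sum.cong refl ext_End_simps(3)[OF F]) (auto intro: ext_alg_closed)
      finally show ?thesis .
    qed
    moreover have "(\<Sum>S\<in>Pow I. ext_scale (v S) (D (ext_mono S)))
        = (\<Sum>S\<in>Pow I. ext_scale (v S) (D' (ext_mono S)))"
    proof (rule sum.cong[OF refl])
      fix S assume "S \<in> Pow I"
      then have "S \<subseteq> I" "finite S" using I finite_subset by auto
      then show "ext_scale (v S) (D (ext_mono S)) = ext_scale (v S) (D' (ext_mono S))"
        using mono by simp
    qed
    ultimately show "D v = D' v"
      using lin by simp
  qed
qed

text \<open>The derivative with respect to one of the given generators.\<close>

definition contr :: "'a::linorder \<Rightarrow> 'a ext \<Rightarrow> 'a ext" where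
  "contr a v = (\<lambda>S. if a \<in> S then 0 else ext_sign {a} S * v (insert a S))"

lemma sum_Pow_insert:
  assumes "finite R" "a \<notin> R"
  shows "sum g (Pow (insert a R)) = (\<Sum>T\<in>Pow R. g T + g (insert a T))"
proof -
  have "sum g (Pow (insert a R)) = sum g (Pow R) + sum g (insert a ` Pow R)"
    unfolding Pow_insert by (rule sum.union_disjoint) (use assms in auto)
  also have "sum g (insert a ` Pow R) = (\<Sum>T\<in>Pow R. g (insert a T))"
    using assms by (subst sum.reindex) (auto simp: inj_on_def)
  finally show ?thesis by (simp add: sum.distrib)
qed

lemma contr_mult: "contr a (v \<odot> w) = contr a v \<odot> w + parity v \<odot> contr a w"
proof
  fix S
  consider "infinite S" | "finite S" "a \<notin> S" | R where "finite R" "a \<notin> R" "S = insert a R"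
    by (metis finite_insert mk_disjoint_insert)
  then show "contr a (v \<odot> w) S = (contr a v \<odot> w + parity v \<odot> contr a w) S"
  proof cases
    case 1
    then show ?thesis by (simp add: contr_def ext_mult_infinite)
  next
    case 2
    have *: "ext_sign {a} S * (ext_sign T (insert a S - T) * v T * w (insert a S - T)
          + ext_sign (insert a T) (insert a S - insert a T) * v (insert a T) * w (insert a S - insert a T))
        = ext_sign T (S - T) * contr a v T * w (S - T) + ext_sign T (S - T) * parity v T * contr a w (S - T)"
      if T: "T \<in> Pow S" for T
    proof -
      define R where "R = S - T"
      have R: "insert a S - T = insert a R" "insert a S - insert a T = R" "S = T \<union> R" "T \<inter> R = {}"
        "a \<notin> T" "a \<notin> R" "finite T" "finite R"
        using T 2 finite_subset by (auto simp: R_def)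
      have e: "ext_sign {a} S = ext_sign {a} T * ext_sign {a} R"
        using R by (simp add: ext_sign_Un_right)
      have par: "parity v T = ext_sign {a} T * ext_sign T {a} * v T"
        using R by (simp add: parity_def ext_sign_swap)
      have sq: "ext_sign {a} R * (ext_sign {a} R * z) = z" for z
        by (simp flip: mult.assoc)
      have ins: "ext_sign T (insert a R) = ext_sign T {a} * ext_sign T R"
        "ext_sign (insert a T) R = ext_sign {a} R * ext_sign T R"
        by (rule ext_sign_insert; use R in blast)+
      have con: "contr a v T = ext_sign {a} T * v (insert a T)" "contr a w R = ext_sign {a} R * w (insert a R)"
        using R by (simp_all add: contr_def)
      show ?thesis
        unfolding R_def[symmetric] R(1,2) e par ins con
        by (simp add: algebra_simps sq)
    qed
    have "contr a (v \<odot> w) S = ext_sign {a} S * (v \<odot> w) (insert a S)"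
      using 2 by (simp add: contr_def)
    also have "\<dots> = (\<Sum>T\<in>Pow S. ext_sign {a} S * (ext_sign T (insert a S - T) * v T * w (insert a S - T)
          + ext_sign (insert a T) (insert a S - insert a T) * v (insert a T) * w (insert a S - insert a T)))"
      unfolding ext_mult_def sum_Pow_insert[OF 2] sum_distrib_left ..
    also have "\<dots> = (\<Sum>T\<in>Pow S. ext_sign T (S - T) * contr a v T * w (S - T)
        + ext_sign T (S - T) * parity v T * contr a w (S - T))"
      by (intro sum.cong refl *)
    also have "\<dots> = (contr a v \<odot> w + parity v \<odot> contr a w) S"
      by (simp add: ext_mult_def sum.distrib)
    finally show ?thesis .
  next
    case 3
    have "ext_sign T (S - T) * contr a v T * w (S - T) + ext_sign T (S - T) * parity v T * contr a w (S - T)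
        + (ext_sign (insert a T) (S - insert a T) * contr a v (insert a T) * w (S - insert a T)
          + ext_sign (insert a T) (S - insert a T) * parity v (insert a T) * contr a w (S - insert a T)) = 0"
      if T: "T \<in> Pow R" for T
    proof -
      define Q where "Q = R - T"
      have Q: "S - T = insert a Q" "S - insert a T = Q" "a \<notin> T" "a \<notin> Q" "finite T" "finite Q"
        using T 3 finite_subset by (auto simp: Q_def)
      have par: "parity v (insert a T) = - (ext_sign {a} T * ext_sign T {a} * v (insert a T))"
        using Q by (simp add: parity_def ext_sign_swap)
      have sq: "ext_sign {a} Q * (ext_sign {a} Q * z) = z" for z
        by (simp flip: mult.assoc)
      have ins: "ext_sign T (insert a Q) = ext_sign T {a} * ext_sign T Q"
        "ext_sign (insert a T) Q = ext_sign {a} Q * ext_sign T Q"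
        by (rule ext_sign_insert; use Q in blast)+
      have con: "contr a v T = ext_sign {a} T * v (insert a T)" "contr a w Q = ext_sign {a} Q * w (insert a Q)"
        "contr a v (insert a T) = 0" "contr a w (insert a Q) = 0"
        using Q by (simp_all add: contr_def)
      show ?thesis
        unfolding Q(1,2) par ins con by (simp add: algebra_simps sq)
    qed
    then have "(\<Sum>T\<in>Pow S. ext_sign T (S - T) * contr a v T * w (S - T)
        + ext_sign T (S - T) * parity v T * contr a w (S - T)) = 0"
      unfolding 3(3) sum_Pow_insert[OF 3(1,2)] by (intro sum.neutral) simp
    then have "(contr a v \<odot> w + parity v \<odot> contr a w) S = 0"
      by (simp add: ext_mult_def sum.distrib)
    then show ?thesis
      using 3 by (simp add: contr_def)
  qed
qed

lemma odd_derivation_contr_sum: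
  assumes "finite I" "\<And>p. p \<in> P \<Longrightarrow> b p \<in> I"
  shows "odd_derivation I (\<lambda>v\<in>ext_alg I. \<Sum>p\<in>P. ext_scale (c p) (contr (b p) v))"
proof -
  define D where "D v = (\<Sum>p\<in>P. ext_scale (c p) (contr (b p) v))" for v
  have D_apply: "D v S = (\<Sum>p\<in>P. c p * contr (b p) v S)" for v S
    by (simp add: D_def sum_fun_apply ext_scale_def)
  have cl: "D v \<in> ext_alg I" if "v \<in> ext_alg I" for v
    unfolding D_def
  proof (intro ext_alg_sum ext_alg_closed)
    show "contr (b p) v \<in> ext_alg I" for p
      using that by (auto simp: ext_alg_def contr_def)
  qed
  have contr_add: "contr a (v + w) S = contr a v S + contr a w S"
    and contr_scale: "contr a (ext_scale d v) S = d * contr a v S" for a :: 'a and d v w S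
    by (simp_all add: contr_def ext_scale_def distrib_left)
  have add: "D (v + w) = D v + D w" for v w
    by (rule ext) (simp add: D_apply contr_add distrib_left sum.distrib)
  have scale: "D (ext_scale d v) = ext_scale d (D v)" for d v
    by (rule ext) (simp add: D_apply contr_scale ext_scale_def[of d "D v"] sum_distrib_left mult.left_commute)
  have leib: "D (v \<odot> w) = D v \<odot> w + parity v \<odot> D w" for v w
  proof
    fix S
    have "(D v \<odot> w) S = (\<Sum>p\<in>P. c p * (contr (b p) v \<odot> w) S)"
      unfolding ext_mult_def D_apply sum_distrib_left sum_distrib_right
      by (subst sum.swap) (simp add: mult_ac)
    moreover have "(parity v \<odot> D w) S = (\<Sum>p\<in>P. c p * (parity v \<odot> contr (b p) w) S)"
      unfolding ext_mult_def D_apply sum_distrib_left sum_distrib_right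
      by (subst sum.swap) (simp add: mult_ac)
    ultimately show "D (v \<odot> w) S = (D v \<odot> w + parity v \<odot> D w) S"
      by (simp add: D_apply contr_mult algebra_simps sum.distrib)
  qed
  show ?thesis
    unfolding D_def[symmetric] odd_derivation_def ext_End_def
    using cl by (auto simp: add scale leib ext_mult_closed ext_alg_closed)
qed

lemma alternating_binomial_sum:
  "(\<Sum>q\<le>j. (if s \<le> q then (- 1) ^ (q - s) * of_nat (q choose s) else 0) * of_nat (j choose q))
    = (if j = s then 1 else (0 :: complex))"
proof (cases "s \<le> j")
  case True
  have "(\<Sum>q\<le>j. (if s \<le> q then (- 1) ^ (q - s) * of_nat (q choose s) else 0) * of_nat (j choose q))
      = (\<Sum>q\<in>{s..j}. of_nat (j choose s) * ((- 1) ^ (q - s) * of_nat ((j - s) choose (q - s))) :: complex)"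
  proof (rule sum.mono_neutral_cong_right)
    fix q assume q: "q \<in> {s..j}"
    have "of_nat ((j choose q) * (q choose s)) = (of_nat ((j choose s) * ((j - s) choose (q - s))) :: complex)"
      using q by (simp only: choose_mult atLeastAtMost_iff)
    then show "(if s \<le> q then (- 1) ^ (q - s) * of_nat (q choose s) else 0) * of_nat (j choose q)
        = of_nat (j choose s) * ((- 1) ^ (q - s) * of_nat ((j - s) choose (q - s)) :: complex)"
      using q by (simp add: mult_ac)
  qed auto
  also have "\<dots> = of_nat (j choose s) * (\<Sum>q\<in>{s..j}. (- 1) ^ (q - s) * of_nat ((j - s) choose (q - s)))"
    by (simp add: sum_distrib_left)
  also have "(\<Sum>q\<in>{s..j}. (- 1) ^ (q - s) * of_nat ((j - s) choose (q - s)))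
      = (\<Sum>u\<le>j - s. (- 1) ^ u * of_nat ((j - s) choose u) :: complex)"
    by (rule sum.reindex_bij_witness[of _ "\<lambda>u. u + s" "\<lambda>q. q - s"]) (use True in auto)
  also have "\<dots> = (if j = s then 1 else 0)"
    using True choose_alternating_sum[of "j - s", where ?'a = complex] by auto
  finally show ?thesis by auto
qed (auto intro!: sum.neutral)

lemma partial_x_ex1:
  assumes k: "k \<in> {1..n}" and s: "s < r"
  shows "\<exists>!D. is_partial_x n r k s D"
proof (rule ex_ex1I)
  have fin: "finite (vars n r)"
    by (simp add: vars_def)
  have y_in: "y_var i (r - 1 - q) \<in> ext_V n r" if "i \<in> {1..n}" "q < r" for i q
    unfolding y_var_def by (rule ext_alg_closed) (use that in \<open>auto simp: vars_def\<close>)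
  define c :: "nat \<Rightarrow> complex" where "c q = (if s \<le> q then (- 1) ^ (q - s) * of_nat (q choose s) else 0)" for q
  define D where "D = (\<lambda>v\<in>ext_V n r. \<Sum>q<r. ext_scale (c q) (contr (k, r - 1 - q) v))"
  have der: "odd_derivation (vars n r) D"
    unfolding D_def by (rule odd_derivation_contr_sum[OF fin]) (use k in \<open>auto simp: vars_def\<close>)
  then have lin: "D \<in> ext_End (ext_V n r)"
    by (simp add: odd_derivation_def)
  have Dy: "D (y_var i (r - 1 - q)) = (if i = k then ext_scale (c q) (ext_mono {}) else 0)"
    if "i \<in> {1..n}" "q < r" for i q
  proof
    fix S
    have "D (y_var i (r - 1 - q)) S = (\<Sum>p<r. c p * contr (k, r - 1 - p) (y_var i (r - 1 - q)) S)"
      using y_in[OF that] by (simp add: D_def sum_fun_apply ext_scale_def)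
    also have "\<dots> = (\<Sum>p<r. if p = q then if i = k \<and> S = {} then c p else 0 else 0)"
    proof (rule sum.cong[OF refl])
      fix p assume "p \<in> {..<r}"
      then have *: "r - 1 - p = r - 1 - q \<longleftrightarrow> p = q"
        using that by auto
      have "contr a (ext_gen b) S = (if a = b \<and> S = {} then 1 else 0)" for a b :: "nat \<times> nat"
        by (auto simp: contr_def ext_mono_def)
      then show "c p * contr (k, r - 1 - p) (y_var i (r - 1 - q)) S
          = (if p = q then if i = k \<and> S = {} then c p else 0 else 0)"
        using * by (auto simp: y_var_def)
    qed
    also have "\<dots> = (if i = k then ext_scale (c q) (ext_mono {}) else 0) S"
      using that by (auto simp: ext_scale_def ext_mono_def)
    finally show "D (y_var i (r - 1 - q)) S = (if i = k then ext_scale (c q) (ext_mono {}) else 0) S" .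
  qed
  have Fx: "F (x_var r i j) = (\<Sum>q\<le>j. ext_scale (of_nat (j choose q)) (F (y_var i (r - 1 - q))))"
    if F: "F \<in> ext_End (ext_V n r)" and "i \<in> {1..n}" "j < r" for F i j
    unfolding x_var_def using that
    by (subst ext_End_sum[OF F])
      (auto intro!: sum.cong ext_alg_closed y_in ext_End_simps(3)[OF F] simp del: One_nat_def diff_diff_left)
  have "D (x_var r i j) = (if i = k \<and> j = s then ext_mono {} else 0)"
    if ij: "i \<in> {1..n}" "j < r" for i j
  proof
    fix S
    have "D (x_var r i j) S = (\<Sum>q\<le>j. of_nat (j choose q) * (if i = k \<and> S = {} then c q else 0))"
      unfolding Fx[OF lin ij] sum_fun_apply
      by (intro sum.cong) (use ij in \<open>auto simp: ext_scale_def ext_mono_def Dy simp del: One_nat_def diff_diff_left\<close>)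
    also have "\<dots> = (if i = k \<and> S = {} then (\<Sum>q\<le>j. c q * of_nat (j choose q)) else 0)"
      by (cases "i = k"; cases "S = {}") (simp_all add: mult.commute)
    also have "(\<Sum>q\<le>j. c q * of_nat (j choose q)) = (if j = s then 1 else 0)"
      unfolding c_def by (rule alternating_binomial_sum)
    finally show "D (x_var r i j) S = (if i = k \<and> j = s then ext_mono {} else 0) S"
      by (auto simp: ext_mono_def)
  qed
  with der show "\<exists>D. is_partial_x n r k s D"
    by (auto simp: is_partial_x_def)

  fix D D'
  assume DD': "is_partial_x n r k s D" "is_partial_x n r k s D'"
  then have lin: "D \<in> ext_End (ext_V n r)" "D' \<in> ext_End (ext_V n r)"
    by (auto simp: is_partial_x_def odd_derivation_def)
  have y: "D (y_var i (r - 1 - q)) = D' (y_var i (r - 1 - q))" if "i \<in> {1..n}" "q < r" for i q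
    using that
  proof (induction q rule: less_induct)
    case (less q)
    have split: "{..q} = insert q {..<q}" by auto
    have one: "ext_scale (of_nat (q choose q)) v = v" for v :: "(nat \<times> nat) ext"
      by (simp add: ext_scale_def)
    have "D (x_var r i q) = D' (x_var r i q)"
      using DD' less by (auto simp: is_partial_x_def)
    moreover have "F (x_var r i q) = F (y_var i (r - 1 - q))
        + (\<Sum>p<q. ext_scale (of_nat (q choose p)) (F (y_var i (r - 1 - p))))"
      if F: "F \<in> ext_End (ext_V n r)" for F
      unfolding Fx[OF F less.prems] split by (simp add: one del: One_nat_def diff_diff_left binomial_n_n)
    moreover have "(\<Sum>p<q. ext_scale (of_nat (q choose p)) (D (y_var i (r - 1 - p))))
        = (\<Sum>p<q. ext_scale (of_nat (q choose p)) (D' (y_var i (r - 1 - p))))"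
      using less by (intro sum.cong) auto
    ultimately show ?case
      using lin by (metis (no_types, lifting) add_right_cancel)
  qed
  show "D = D'"
  proof (rule odd_derivation_eqI[OF fin])
    show "odd_derivation (vars n r) D" "odd_derivation (vars n r) D'"
      using DD' by (auto simp: is_partial_x_def)
    fix a assume "a \<in> vars n r"
    then obtain i j where a: "a = (i, j)" "i \<in> {1..n}" "j < r"
      by (auto simp: vars_def)
    have "r - 1 - (r - 1 - j) = j" "r - 1 - j < r"
      using a by auto
    then show "D (ext_gen a) = D' (ext_gen a)"
      using y[OF a(2), of "r - 1 - j"] by (simp add: y_var_def a)
  qed
qed

lemma is_partial_x_partial_x:
  assumes "k \<in> {1..n}" "s < r"
  shows "is_partial_x n r k s (partial_x n r k s)"
  unfolding partial_x_def by (rule theI'[OF partial_x_ex1[OF assms]])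

end

theory Submission
  imports Defs "HOL-Computational_Algebra.Polynomial"
begin

text \<open>
  Left multiplications by the \<open>x\<^sub>p\<close> and the derivatives \<open>\<partial>\<^sub>q\<close> satisfy the canonical
  anticommutation relations, so \<open>B \<mapsto> \<Sum>\<^sub>p\<^sub>,\<^sub>q B\<^sub>p\<^sub>q x\<^sub>p \<partial>\<^sub>q\<close> takes matrix commutators to commutators
  of operators.  Since \<open>t \<mapsto> \<ell>\<^sub>j(m + t)\<close> has degree less than \<open>r\<close>, interpolating it at
  \<open>0, \<dots>, r - 1\<close> gives \<open>\<Sum>\<^sub>s \<ell>\<^sub>j(m + s) \<ell>\<^sub>s(m' + s') = \<ell>\<^sub>j(m + m' + s')\<close>:  the matrices
  \<open>(\<ell>\<^sub>j(m + s))\<^sub>j\<^sub>s\<close> multiply like the powers \<open>t\<^sup>m\<close>.  Hence \<open>\<psi>\<close> factors through a homomorphism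
  from the loop algebra to \<open>nr \<times> nr\<close> matrices.
\<close>

section \<open>Linearity of the exterior product\<close>

interpretation ext: vector_space "ext_scale :: complex \<Rightarrow> 'a ext \<Rightarrow> 'a ext"
  by standard (auto simp: ext_scale_def fun_eq_iff algebra_simps)

lemma ext_mult_sum_left: "(\<Sum>i\<in>A. f i) \<odot> v = (\<Sum>i\<in>A. f i \<odot> v)"
proof
  fix S
  show "((\<Sum>i\<in>A. f i) \<odot> v) S = (\<Sum>i\<in>A. f i \<odot> v) S"
    unfolding ext_mult_def sum_fun_apply sum_distrib_left sum_distrib_right
    by (rule sum.swap)
qed

lemma ext_mult_sum_right: "v \<odot> (\<Sum>i\<in>A. f i) = (\<Sum>i\<in>A. v \<odot> f i)"
proof
  fix S
  show "(v \<odot> (\<Sum>i\<in>A. f i)) S = (\<Sum>i\<in>A. v \<odot> f i) S"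
    unfolding ext_mult_def sum_fun_apply sum_distrib_left sum_distrib_right
    by (rule sum.swap)
qed

lemma ext_mult_scale:
  "ext_scale c v \<odot> w = ext_scale c (v \<odot> w)" "v \<odot> ext_scale c w = ext_scale c (v \<odot> w)"
  by (auto simp: ext_mult_def ext_scale_def fun_eq_iff sum_distrib_left mult_ac)

lemma ext_mult_linear:
  "v \<odot> 0 = 0" "0 \<odot> w = 0"
  "v \<odot> (w + w') = v \<odot> w + v \<odot> w'" "(v + v') \<odot> w = v \<odot> w + v' \<odot> w"
  "v \<odot> - w = - (v \<odot> w)" "(- v) \<odot> w = - (v \<odot> w)"
  by (auto simp: ext_mult_def fun_eq_iff algebra_simps sum.distrib sum_negf)

section \<open>Parity and odd derivations\<close>

lemma parity_ext_gen: "parity (ext_gen a) = - ext_gen a"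
  by (auto simp: parity_def ext_mono_def fun_eq_iff)

lemma odd_derivation_ext_End: "odd_derivation I D \<Longrightarrow> D \<in> ext_End (ext_alg I)"
  by (simp add: odd_derivation_def)

lemma odd_derivation_mult:
  "\<lbrakk>odd_derivation I D; v \<in> ext_alg I; w \<in> ext_alg I\<rbrakk> \<Longrightarrow> D (v \<odot> w) = D v \<odot> w + parity v \<odot> D w"
  by (simp add: odd_derivation_def)

text \<open>The monomial of the empty set is an idempotent fixed by \<open>parity\<close>, so the
  Leibniz rule for its square reads \<open>D 1 = D 1 + D 1\<close>.\<close>

lemma odd_derivation_one:
  fixes I :: "'a::linorder set"
  assumes I: "finite I" and D: "odd_derivation I D"
  shows "D (ext_mono {}) = 0"
proof -
  have one: "ext_mono {} \<in> ext_alg I"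
    by (simp add: ext_alg_closed)
  have D1: "D (ext_mono {}) \<in> ext_alg I"
    by (rule ext_End_simps(1)[OF odd_derivation_ext_End[OF D] one])
  have "parity (ext_mono {} :: 'a ext) = ext_mono {}"
    by (auto simp: parity_def ext_mono_def fun_eq_iff)
  then have "D (ext_mono {}) = D (ext_mono {}) + D (ext_mono {})"
    using odd_derivation_mult[OF D one one] by (simp only: ext_mult_one[OF I one] ext_mult_one[OF I D1])
  then show ?thesis by simp
qed

text \<open>The anticommutator commutes with left multiplication by generators and kills \<open>1\<close>.\<close>

lemma odd_derivation_anticommute:
  fixes I :: "'a::linorder set"
  assumes I: "finite I" and D: "odd_derivation I D" and D': "odd_derivation I D'"
    and gen: "\<And>a. a \<in> I \<Longrightarrow> D (ext_gen a) = ext_scale (c a) (ext_mono {})"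
      "\<And>a. a \<in> I \<Longrightarrow> D' (ext_gen a) = ext_scale (c' a) (ext_mono {})"
    and v: "v \<in> ext_alg I"
  shows "D (D' v) = - D' (D v)"
proof -
  note lin = odd_derivation_ext_End[OF D] odd_derivation_ext_End[OF D']
  have cl: "D v \<in> ext_alg I" "D' v \<in> ext_alg I" if "v \<in> ext_alg I" for v
    using that lin by (auto intro: ext_End_simps)
  \<comment> \<open>The value at \<open>0\<close> is additivity over the empty sum.\<close>
  have zero: "D 0 = 0" "D' 0 = 0"
    using ext_End_sum[OF lin(1), of "{}"] ext_End_sum[OF lin(2), of "{}"] by simp_all
  \<comment> \<open>The sign comes from the parity of a generator. It is written as a scalar factor
    so that the linearity rules of \<open>ext_End\<close> apply to it.\<close>
  have leib: "F (ext_gen a \<odot> v) = ext_scale (e a) v + ext_scale (- 1) (ext_gen a \<odot> F v)"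
    if F: "odd_derivation I F" "\<And>a. a \<in> I \<Longrightarrow> F (ext_gen a) = ext_scale (e a) (ext_mono {})"
      and a: "a \<in> I" "v \<in> ext_alg I" for F e a v
    using odd_derivation_mult[OF F(1) _ a(2), of "ext_gen a"] a F(2)[OF a(1)]
    by (simp add: ext_alg_closed ext_mult_scale ext_mult_one[OF I a(2)] parity_ext_gen ext_mult_linear)
  have mono: "D (D' (ext_mono S)) = - D' (D (ext_mono S))" if "finite S" "S \<subseteq> I" for S
    using that
  proof (induction S)
    case empty
    then show ?case using odd_derivation_one[OF I D] odd_derivation_one[OF I D'] zero by (simp only: minus_zero)
  next
    case (insert a S)
    define w where "w = ext_mono S"
    have a: "a \<in> I" and w: "w \<in> ext_alg I" and g: "ext_gen a \<in> ext_alg I"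
      using insert by (auto simp: w_def ext_alg_closed)
    have IH: "D (D' w) = - D' (D w)"
      using insert unfolding w_def by blast
    \<comment> \<open>Applying \<open>leib\<close> twice leaves the mixed terms
      \<open>e' F - e F'\<close>, which change sign when \<open>F\<close> and \<open>F'\<close> are
      exchanged. They therefore cancel in the anticommutator, and the last term falls to the
      induction hypothesis.\<close>
    have step: "F (F' (ext_gen a \<odot> w)) = ext_scale (e' a) (F w) - ext_scale (e a) (F' w)
        + ext_gen a \<odot> F (F' w)"
      if F: "odd_derivation I F" "\<And>a. a \<in> I \<Longrightarrow> F (ext_gen a) = ext_scale (e a) (ext_mono {})"
       and F': "odd_derivation I F'" "\<And>a. a \<in> I \<Longrightarrow> F' (ext_gen a) = ext_scale (e' a) (ext_mono {})"
     for F F' e e'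
    proof -
      note FE = odd_derivation_ext_End[OF F(1)] and FE' = odd_derivation_ext_End[OF F'(1)]
      have w': "F' w \<in> ext_alg I"
        by (rule ext_End_simps(1)[OF FE' w])
      have "F (F' (ext_gen a \<odot> w)) = F (ext_scale (e' a) w + ext_scale (- 1) (ext_gen a \<odot> F' w))"
        by (simp add: leib[OF F' a w])
      also have "\<dots> = F (ext_scale (e' a) w) + F (ext_scale (- 1) (ext_gen a \<odot> F' w))"
        by (rule ext_End_simps(2)[OF FE]) (intro ext_alg_closed ext_mult_closed w w' g)+
      also have "\<dots> = ext_scale (e' a) (F w) + ext_scale (- 1) (F (ext_gen a \<odot> F' w))"
        using w w' g by (simp only: ext_End_simps(3)[OF FE] ext_mult_closed)
      also have "\<dots> = ext_scale (e' a) (F w) - ext_scale (e a) (F' w) + ext_gen a \<odot> F (F' w)"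
        by (simp add: leib[OF F a w'] ext.scale_right_distrib)
      finally show ?thesis .
    qed
    have "D (D' (ext_gen a \<odot> w)) = - D' (D (ext_gen a \<odot> w))"
      unfolding step[OF D gen(1) D' gen(2), simplified] step[OF D' gen(2) D gen(1), simplified] IH
      by (simp add: ext_mult_linear)
    \<comment> \<open>A sign is its own inverse, so the multiplication rule can be solved for the
      larger monomial.\<close>
    moreover have "ext_mono (insert a S) = ext_scale (ext_sign {a} S) (ext_gen a \<odot> w)"
      using insert by (simp add: ext_gen_mult_mono w_def)
    ultimately show ?case
      using g w by (simp only: ext_End_simps(3)[OF lin(1)] ext_End_simps(3)[OF lin(2)]
          ext_mult_closed cl ext.scale_minus_right)
  qed
  have expand: "F (F' v) = (\<Sum>S\<in>Pow I. ext_scale (v S) (F (F' (ext_mono S))))"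
    if F: "F \<in> ext_End (ext_alg I)" and F': "F' \<in> ext_End (ext_alg I)" for F F'
  proof -
    have "F (F' v) = F (F' (\<Sum>S\<in>Pow I. ext_scale (v S) (ext_mono S)))"
      using ext_expansion[OF I v] by simp
    also have "\<dots> = F (\<Sum>S\<in>Pow I. F' (ext_scale (v S) (ext_mono S)))"
      by (subst ext_End_sum[OF F']) (auto intro: ext_alg_closed)
    also have "\<dots> = (\<Sum>S\<in>Pow I. F (F' (ext_scale (v S) (ext_mono S))))"
      by (rule ext_End_sum[OF F]) (auto intro: ext_alg_closed ext_End_simps(1)[OF F'])
    also have "\<dots> = (\<Sum>S\<in>Pow I. ext_scale (v S) (F (F' (ext_mono S))))"
      by (intro sum.cong) (auto simp: ext_End_simps[OF F'] ext_End_simps[OF F] ext_alg_closed)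
    finally show ?thesis .
  qed
  have "(\<Sum>S\<in>Pow I. ext_scale (v S) (D (D' (ext_mono S))))
      = (\<Sum>S\<in>Pow I. - ext_scale (v S) (D' (D (ext_mono S))))"
  proof (rule sum.cong[OF refl])
    fix S assume "S \<in> Pow I"
    then have "S \<subseteq> I" "finite S"
      using I finite_subset by auto
    then show "ext_scale (v S) (D (D' (ext_mono S))) = - ext_scale (v S) (D' (D (ext_mono S)))"
      by (simp only: mono ext.scale_minus_right)
  qed
  then show ?thesis
    unfolding expand[OF lin] expand[OF lin(2,1)] sum_negf .
qed

section \<open>Quadratic operators under canonical anticommutation relations\<close>

text \<open>The index set \<open>J\<close> is kept apart from the variables \<open>I\<close>,
  because the \<open>x p\<close> may be arbitrary elements rather than monomials. Only the relations
  enter the commutator formula. Those for \<open>d\<close> are stated on vectors of the space, since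
  its endomorphisms are extensional functions.\<close>

locale anticommutation_relations =
  fixes I :: "'a::linorder set" and J :: "'i set"
    and x :: "'i \<Rightarrow> 'a ext" and d :: "'i \<Rightarrow> 'a ext \<Rightarrow> 'a ext"
  assumes finite_J: "finite J"
    and x_closed: "p \<in> J \<Longrightarrow> x p \<in> ext_alg I"
    and d_End: "q \<in> J \<Longrightarrow> d q \<in> ext_End (ext_alg I)"
    and x_x: "\<lbrakk>p \<in> J; q \<in> J\<rbrakk> \<Longrightarrow> x p \<odot> x q = - (x q \<odot> x p)"
    and d_d: "\<lbrakk>p \<in> J; q \<in> J; v \<in> ext_alg I\<rbrakk> \<Longrightarrow> d p (d q v) = - d q (d p v)"
    and d_x: "\<lbrakk>p \<in> J; q \<in> J; v \<in> ext_alg I\<rbrakk>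
      \<Longrightarrow> d q (x p \<odot> v) = (if p = q then v else 0) - x p \<odot> d q v"
begin

definition quadratic :: "('i \<Rightarrow> 'i \<Rightarrow> complex) \<Rightarrow> 'a ext \<Rightarrow> 'a ext" where
  "quadratic B = (\<lambda>v\<in>ext_alg I. \<Sum>p\<in>J. \<Sum>q\<in>J. ext_scale (B p q) (x p \<odot> d q v))"

lemma d_closed: "\<lbrakk>q \<in> J; v \<in> ext_alg I\<rbrakk> \<Longrightarrow> d q v \<in> ext_alg I"
  by (rule ext_End_simps(1)[OF d_End])

lemma quadratic_End: "quadratic B \<in> ext_End (ext_alg I)"
proof -
  have "(\<Sum>p\<in>J. \<Sum>q\<in>J. ext_scale (B p q) (x p \<odot> d q (v + w)))
      = (\<Sum>p\<in>J. \<Sum>q\<in>J. ext_scale (B p q) (x p \<odot> d q v)) + (\<Sum>p\<in>J. \<Sum>q\<in>J. ext_scale (B p q) (x p \<odot> d q w))"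
    if "v \<in> ext_alg I" "w \<in> ext_alg I" for v w
    unfolding sum.distrib[symmetric]
    by (intro sum.cong refl)
      (simp only: ext_End_simps(2)[OF d_End] that ext_mult_linear ext.scale_right_distrib)
  moreover have "(\<Sum>p\<in>J. \<Sum>q\<in>J. ext_scale (B p q) (x p \<odot> d q (ext_scale c v)))
      = ext_scale c (\<Sum>p\<in>J. \<Sum>q\<in>J. ext_scale (B p q) (x p \<odot> d q v))"
    if "v \<in> ext_alg I" for c v
    unfolding ext.scale_sum_right using that
    by (intro sum.cong refl)
      (simp add: ext_End_simps(3)[OF d_End] ext_mult_scale mult.commute)
  ultimately show ?thesis
    unfolding quadratic_def ext_End_def
    by (auto simp: ext_alg_closed intro!: ext_alg_sum ext_alg_closed ext_mult_closed x_closed d_closed)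
qed

text \<open>Normal ordering: moving \<open>d q\<close> to the right past \<open>x p'\<close> leaves
  a Kronecker delta, which contracts the two coefficient matrices to their product, and a quartic
  term with a minus sign.\<close>

lemma quadratic_quadratic:
  assumes v: "v \<in> ext_alg I"
  shows "quadratic B (quadratic C v) = quadratic (\<lambda>p s. \<Sum>q\<in>J. B p q * C q s) v
    - (\<Sum>p\<in>J. \<Sum>q\<in>J. \<Sum>p'\<in>J. \<Sum>q'\<in>J. ext_scale (B p q * C p' q') ((x p \<odot> x p') \<odot> d q (d q' v)))"
proof -
  have "x p \<odot> d q (quadratic C v) = (\<Sum>s\<in>J. ext_scale (C q s) (x p \<odot> d s v))
      - (\<Sum>p'\<in>J. \<Sum>q'\<in>J. ext_scale (C p' q') ((x p \<odot> x p') \<odot> d q (d q' v)))"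
    if p: "p \<in> J" and q: "q \<in> J" for p q
  proof -
    have "d q (quadratic C v) = d q (\<Sum>p'\<in>J. \<Sum>q'\<in>J. ext_scale (C p' q') (x p' \<odot> d q' v))"
      using v by (simp add: quadratic_def)
    also have "\<dots> = (\<Sum>p'\<in>J. d q (\<Sum>q'\<in>J. ext_scale (C p' q') (x p' \<odot> d q' v)))"
      by (rule ext_End_sum[OF d_End[OF q]])
        (intro ext_alg_sum ext_alg_closed ext_mult_closed x_closed d_closed v)
    also have "\<dots> = (\<Sum>p'\<in>J. \<Sum>q'\<in>J. d q (ext_scale (C p' q') (x p' \<odot> d q' v)))"
      by (intro sum.cong refl ext_End_sum[OF d_End[OF q]])
        (intro ext_alg_closed ext_mult_closed x_closed d_closed v)
    \<comment> \<open>The delta of \<open>d_x\<close> forces \<open>p' = q\<close>, so the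
      coefficient in that branch can be written as \<open>C q q'\<close>.\<close>
    also have "\<dots> = (\<Sum>p'\<in>J. \<Sum>q'\<in>J. (if p' = q then ext_scale (C q q') (d q' v) else 0)
        - ext_scale (C p' q') (x p' \<odot> d q (d q' v)))"
      by (intro sum.cong refl)
        (use q v in \<open>auto simp: ext_End_simps(3)[OF d_End] ext_mult_closed x_closed d_closed d_x
            ext.scale_right_diff_distrib\<close>)
    also have "\<dots> = (\<Sum>q'\<in>J. \<Sum>p'\<in>J. if p' = q then ext_scale (C q q') (d q' v) else 0)
        - (\<Sum>p'\<in>J. \<Sum>q'\<in>J. ext_scale (C p' q') (x p' \<odot> d q (d q' v)))"
      unfolding sum_subtractf by (subst sum.swap) simp
    also have "(\<Sum>q'\<in>J. \<Sum>p'\<in>J. if p' = q then ext_scale (C q q') (d q' v) else 0)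
        = (\<Sum>q'\<in>J. ext_scale (C q q') (d q' v))"
      using q finite_J by simp
    finally show ?thesis
      \<comment> \<open>\<open>ext_mult_linear\<close> speaks of sums and negation, so the
        difference is first put in that form.\<close>
      unfolding diff_conv_add_uminus
      by (simp only: ext_mult_linear ext_mult_sum_right ext_mult_scale ext_mult_assoc)
  qed
  then have "quadratic B (quadratic C v)
      = (\<Sum>p\<in>J. \<Sum>q\<in>J. (\<Sum>s\<in>J. ext_scale (B p q * C q s) (x p \<odot> d s v))
        - (\<Sum>p'\<in>J. \<Sum>q'\<in>J. ext_scale (B p q * C p' q') ((x p \<odot> x p') \<odot> d q (d q' v))))"
    using ext_End_simps(1)[OF quadratic_End v]
    by (simp add: quadratic_def[of B] ext.scale_right_diff_distrib ext.scale_sum_right)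
  moreover have "(\<Sum>q\<in>J. \<Sum>s\<in>J. ext_scale (B p q * C q s) (x p \<odot> d s v))
      = (\<Sum>s\<in>J. ext_scale (\<Sum>q\<in>J. B p q * C q s) (x p \<odot> d s v))" for p
    unfolding ext.scale_sum_left by (rule sum.swap)
  ultimately show ?thesis
    using v by (simp add: sum_subtractf quadratic_def)
qed

text \<open>
  The quartic terms of the two products agree: exchanging both pairs of odd factors produces two
  signs, which cancel.
\<close>

lemma quadratic_commutator:
  assumes v: "v \<in> ext_alg I"
  shows "quadratic B (quadratic C v) - quadratic C (quadratic B v)
    = quadratic (\<lambda>p s. \<Sum>q\<in>J. B p q * C q s - C p q * B q s) v"
proof -
  define Q where "Q B C p q p' q' = ext_scale (B p q * C p' q') ((x p \<odot> x p') \<odot> d q (d q' v))"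
    for B C p q p' q'
  have swap: "Q B C p q p' q' = Q C B p' q' p q" if "p \<in> J" "q \<in> J" "p' \<in> J" "q' \<in> J" for p q p' q'
    unfolding Q_def using x_x[of p p'] d_d[of q q' v] that v by (simp add: ext_mult_linear mult.commute)
  have "(\<Sum>p\<in>J. \<Sum>q\<in>J. \<Sum>p'\<in>J. \<Sum>q'\<in>J. Q B C p q p' q')
      = (\<Sum>(p, q)\<in>J \<times> J. \<Sum>(p', q')\<in>J \<times> J. Q B C p q p' q')"
    by (simp flip: sum.cartesian_product)
  also have "\<dots> = (\<Sum>(p, q)\<in>J \<times> J. \<Sum>(p', q')\<in>J \<times> J. Q C B p' q' p q)"
    by (intro sum.cong refl) (auto intro!: sum.cong swap)
  also have "\<dots> = (\<Sum>(p, q)\<in>J \<times> J. \<Sum>(p', q')\<in>J \<times> J. Q C B p q p' q')"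
    unfolding case_prod_beta by (rule sum.swap)
  also have "\<dots> = (\<Sum>p\<in>J. \<Sum>q\<in>J. \<Sum>p'\<in>J. \<Sum>q'\<in>J. Q C B p q p' q')"
    by (simp flip: sum.cartesian_product)
  finally have quartic: "(\<Sum>p\<in>J. \<Sum>q\<in>J. \<Sum>p'\<in>J. \<Sum>q'\<in>J. Q B C p q p' q')
      = (\<Sum>p\<in>J. \<Sum>q\<in>J. \<Sum>p'\<in>J. \<Sum>q'\<in>J. Q C B p q p' q')" .
  have "quadratic B (quadratic C v) - quadratic C (quadratic B v)
      = quadratic (\<lambda>p s. \<Sum>q\<in>J. B p q * C q s) v - quadratic (\<lambda>p s. \<Sum>q\<in>J. C p q * B q s) v"
    using quartic by (simp add: quadratic_quadratic[OF v] Q_def)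
  also have "\<dots> = quadratic (\<lambda>p s. \<Sum>q\<in>J. B p q * C q s - C p q * B q s) v"
    using v by (simp add: quadratic_def ext.scale_left_diff_distrib sum_subtractf)
  finally show ?thesis .
qed

lemma quadratic_cong:
  "(\<And>p q. p \<in> J \<Longrightarrow> q \<in> J \<Longrightarrow> B p q = C p q) \<Longrightarrow> quadratic B = quadratic C"
  unfolding quadratic_def by (intro restrict_ext sum.cong refl) simp

lemma quadratic_add: "quadratic (\<lambda>p q. B p q + C p q) = (\<lambda>v\<in>ext_alg I. quadratic B v + quadratic C v)"
  \<comment> \<open>The type instance restricts extensionality to operators; elements of the
    exterior algebra are not expanded into their coefficients.\<close>
  by (auto simp: quadratic_def fun_eq_iff[where 'a = "'a ext"] ext.scale_left_distrib sum.distrib)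

lemma quadratic_scale: "quadratic (\<lambda>p q. c * B p q) = (\<lambda>v\<in>ext_alg I. ext_scale c (quadratic B v))"
  by (auto simp: quadratic_def fun_eq_iff[where 'a = "'a ext"] ext.scale_sum_right)

end

section \<open>The relations for the variables \<open>x\<close> and their partial
  derivatives\<close>

lemma finite_vars: "finite (vars n r)"
  by (simp add: vars_def)

lemma sum_vars: "(\<Sum>p\<in>vars n r. f p) = (\<Sum>i=1..n. \<Sum>j<r. f (i, j))"
  by (simp add: vars_def sum.cartesian_product)

lemma x_var_closed: "i \<in> {1..n} \<Longrightarrow> j < r \<Longrightarrow> x_var r i j \<in> ext_V n r"
  unfolding x_var_def y_var_def by (intro ext_alg_sum ext_alg_closed) (auto simp: vars_def)

lemma parity_x_var: "parity (x_var r i j) = - x_var r i j"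
proof
  fix S
  show "parity (x_var r i j) S = (- x_var r i j) S"
    unfolding parity_def x_var_def uminus_apply sum_fun_apply sum_distrib_left sum_negf[symmetric]
    by (intro sum.cong refl) (auto simp: y_var_def ext_scale_def ext_mono_def)
qed

text \<open>Both products expand into double sums over the variables \<open>y\<close>, where the
  anticommutation of generators applies term by term.\<close>

lemma x_var_anticommute: "x_var r i j \<odot> x_var r k l = - (x_var r k l \<odot> x_var r i j)"
proof -
  have "x_var r i j \<odot> x_var r k l = (\<Sum>p\<le>j. \<Sum>q\<le>l. ext_scale (of_nat (j choose p) * of_nat (l choose q))
      (y_var i (r - 1 - p) \<odot> y_var k (r - 1 - q)))" for i j k l
    unfolding x_var_def unfolding ext_mult_sum_left unfolding ext_mult_sum_right
    by (intro sum.cong refl) (simp only: ext_mult_scale ext.scale_scale mult.commute)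
  note e = this
  show ?thesis
    unfolding e sum_negf[symmetric] ext.scale_minus_right[symmetric]
    by (subst sum.swap) (simp add: y_var_def mult.commute flip: ext_gen_anticommute del: One_nat_def)
qed

text \<open>
  The matrix of the \<open>x\<^sub>i\<^sub>,\<^sub>j\<close> in terms of the \<open>y\<^sub>i\<^sub>,\<^sub>r\<^sub>-\<^sub>1\<^sub>-\<^sub>q\<close> is unitriangular, so
  scalar values on the former propagate to the latter.
\<close>

lemma derivation_scalar_on_generators:
  assumes D: "odd_derivation (vars n r) D"
    and x: "\<And>i j. i \<in> {1..n} \<Longrightarrow> j < r \<Longrightarrow> \<exists>c. D (x_var r i j) = ext_scale c (ext_mono {})"
    and a: "a \<in> vars n r"
  shows "\<exists>c. D (ext_gen a) = ext_scale c (ext_mono {})"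
proof -
  note lin = odd_derivation_ext_End[OF D]
  have y_in: "y_var i (r - 1 - q) \<in> ext_V n r" if "i \<in> {1..n}" "q < r" for i q
    unfolding y_var_def by (rule ext_alg_closed) (use that in \<open>auto simp: vars_def\<close>)
  have y: "\<exists>c. D (y_var i (r - 1 - q)) = ext_scale c (ext_mono {})" if "i \<in> {1..n}" "q < r" for i q
    using that
  proof (induction q rule: less_induct)
    case (less q)
    have "\<exists>c. \<forall>p<q. D (y_var i (r - 1 - p)) = ext_scale (c p) (ext_mono {})"
      using less by (intro choice) (metis less_trans)
    then obtain c where c: "\<And>p. p < q \<Longrightarrow> D (y_var i (r - 1 - p)) = ext_scale (c p) (ext_mono {})"
      by blast
    obtain e where e: "D (x_var r i q) = ext_scale e (ext_mono {})"
      using x less.prems by blast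
    have split: "{..q} = insert q {..<q}" by auto
    have "D (x_var r i q) = (\<Sum>p\<le>q. D (ext_scale (of_nat (q choose p)) (y_var i (r - 1 - p))))"
      unfolding x_var_def
      by (rule ext_End_sum[OF lin]) (use less.prems in \<open>auto intro!: ext_alg_closed y_in simp del: One_nat_def diff_diff_left\<close>)
    also have "\<dots> = (\<Sum>p\<le>q. ext_scale (of_nat (q choose p)) (D (y_var i (r - 1 - p))))"
      by (intro sum.cong refl ext_End_simps(3)[OF lin] y_in) (use less.prems in auto)
    also have "\<dots> = D (y_var i (r - 1 - q)) + (\<Sum>p<q. ext_scale (of_nat (q choose p)) (D (y_var i (r - 1 - p))))"
      unfolding split by (simp del: One_nat_def diff_diff_left)
    also have "(\<Sum>p<q. ext_scale (of_nat (q choose p)) (D (y_var i (r - 1 - p))))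
        = ext_scale (\<Sum>p<q. of_nat (q choose p) * c p) (ext_mono {})"
      by (simp add: c ext.scale_sum_left del: One_nat_def diff_diff_left)
    finally have eq: "ext_scale e (ext_mono {}) = D (y_var i (r - 1 - q))
        + ext_scale (\<Sum>p<q. of_nat (q choose p) * c p) (ext_mono {})"
      unfolding e .
    have "D (y_var i (r - 1 - q)) = ext_scale (e - (\<Sum>p<q. of_nat (q choose p) * c p)) (ext_mono {})"
      by (simp only: ext.scale_left_diff_distrib eq add_diff_cancel_right')
    then show ?case ..
  qed
  obtain i j where ij: "a = (i, j)" "i \<in> {1..n}" "j < r"
    using a by (auto simp: vars_def)
  then have "r - 1 - (r - 1 - j) = j" "r - 1 - j < r" by auto
  then show ?thesis
    using y[OF ij(2), of "r - 1 - j"] by (simp add: y_var_def ij)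
qed

lemma partial_x:
  assumes "k \<in> {1..n}" "s < r"
  shows "odd_derivation (vars n r) (partial_x n r k s)"
    and "\<lbrakk>i \<in> {1..n}; j < r\<rbrakk>
      \<Longrightarrow> partial_x n r k s (x_var r i j) = (if i = k \<and> j = s then ext_mono {} else 0)"
  using is_partial_x_partial_x[OF assms] by (auto simp: is_partial_x_def)

text \<open>The derivatives are specified on the \<open>x\<close> variables, while
  \<open>odd_derivation_anticommute\<close> asks for scalar values on the \<open>y\<close>
  variables; this bridges the two.\<close>

lemma partial_x_scalar_on_generators:
  assumes "k \<in> {1..n}" "s < r" "a \<in> vars n r"
  shows "\<exists>c. partial_x n r k s (ext_gen a) = ext_scale c (ext_mono {})"
proof (rule derivation_scalar_on_generators[OF partial_x(1)[OF assms(1,2)] _ assms(3)])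
  fix i j assume "i \<in> {1..n}" "j < r"
  then show "\<exists>c. partial_x n r k s (x_var r i j) = ext_scale c (ext_mono {})"
    by (intro exI[of _ "if i = k \<and> j = s then 1 else 0"]) (simp add: partial_x(2)[OF assms(1,2)])
qed

lemma partial_x_anticommute:
  assumes "k \<in> {1..n}" "s < r" "k' \<in> {1..n}" "s' < r" "v \<in> ext_V n r"
  shows "partial_x n r k s (partial_x n r k' s' v) = - partial_x n r k' s' (partial_x n r k s v)"
proof -
  obtain c where "\<And>a. a \<in> vars n r \<Longrightarrow> partial_x n r k s (ext_gen a) = ext_scale (c a) (ext_mono {})"
    using partial_x_scalar_on_generators[OF assms(1,2)] by metis
  moreover obtain c' where "\<And>a. a \<in> vars n r \<Longrightarrow> partial_x n r k' s' (ext_gen a) = ext_scale (c' a) (ext_mono {})"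
    using partial_x_scalar_on_generators[OF assms(3,4)] by metis
  ultimately show ?thesis
    using odd_derivation_anticommute[OF finite_vars partial_x(1) partial_x(1)] assms by blast
qed

lemma partial_x_mult_x_var:
  assumes "k \<in> {1..n}" "s < r" "i \<in> {1..n}" "j < r" "v \<in> ext_V n r"
  shows "partial_x n r k s (x_var r i j \<odot> v)
    = (if i = k \<and> j = s then v else 0) - x_var r i j \<odot> partial_x n r k s v"
  using odd_derivation_mult[OF partial_x(1)[OF assms(1,2)] x_var_closed[OF assms(3,4)] assms(5)]
  unfolding partial_x(2)[OF assms(1-4)]
  by (simp add: parity_x_var ext_mult_linear ext_mult_one[OF finite_vars assms(5)])

text \<open>The set \<open>vars n r\<close> has two roles here: it is the set of variables
  \<open>y\<close> and also the index set of the \<open>x\<close> and their derivatives.\<close>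

interpretation V: anticommutation_relations "vars n r" "vars n r"
  "\<lambda>p. x_var r (fst p) (snd p)" "\<lambda>q. partial_x n r (fst q) (snd q)" for n r
proof
  fix p q v assume "p \<in> vars n r" "q \<in> vars n r" "v \<in> ext_V n r"
  then have *: "fst p \<in> {1..n}" "snd p < r" "fst q \<in> {1..n}" "snd q < r" "v \<in> ext_V n r"
    by (auto simp: vars_def)
  show "partial_x n r (fst p) (snd p) (partial_x n r (fst q) (snd q) v)
      = - partial_x n r (fst q) (snd q) (partial_x n r (fst p) (snd p) v)"
    by (rule partial_x_anticommute[OF *])
  show "partial_x n r (fst q) (snd q) (x_var r (fst p) (snd p) \<odot> v)
      = (if p = q then v else 0) - x_var r (fst p) (snd p) \<odot> partial_x n r (fst q) (snd q) v"
    unfolding partial_x_mult_x_var[OF *(3,4,1,2,5)] by (simp add: prod_eq_iff)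
next
  fix p assume "p \<in> vars n r"
  then have *: "fst p \<in> {1..n}" "snd p < r"
    by (auto simp: vars_def)
  show "x_var r (fst p) (snd p) \<in> ext_V n r"
    by (rule x_var_closed[OF *])
  show "partial_x n r (fst p) (snd p) \<in> ext_End (ext_V n r)"
    by (rule odd_derivation_ext_End[OF partial_x(1)[OF *]])
next
  show "finite (vars n r)"
    by (rule finite_vars)
  show "x_var r (fst p) (snd p) \<odot> x_var r (fst q) (snd q) = - (x_var r (fst q) (snd q) \<odot> x_var r (fst p) (snd p))"
    for p q
    by (rule x_var_anticommute)
qed

section \<open>Lagrange interpolation\<close>

lemma lagrange_poly:
  assumes "j < r"
  obtains p where "degree p < r" "\<And>t. lagrange j r t = poly p t"
proof
  define f :: "nat \<Rightarrow> complex poly" where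
    "f i = smult (1 / (of_nat j - of_nat i)) [:- of_nat i, 1:]" for i
  have "degree (prod f ({..<r} - {j})) \<le> (\<Sum>i\<in>{..<r} - {j}. degree (f i))"
    by (rule degree_prod_sum_le[unfolded o_def]) simp
  also have "\<dots> \<le> (\<Sum>i\<in>{..<r} - {j}. 1)"
    by (intro sum_mono) (auto simp: f_def)
  \<comment> \<open>As \<open>j < r\<close>, leaving out \<open>j\<close> drops one of the
    \<open>r\<close> linear factors.\<close>
  also have "\<dots> < r"
    using assms by simp
  finally show "degree (prod f ({..<r} - {j})) < r" .
  show "lagrange j r t = poly (prod f ({..<r} - {j})) t" for t
    by (simp add: lagrange_def poly_prod f_def diff_divide_distrib)
qed

lemma lagrange_of_nat:
  assumes "s < r"
  shows "lagrange j r (of_nat s) = (if s = j then 1 else 0)"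
  using assms by (auto simp: lagrange_def intro!: prod.neutral)

text \<open>Both sides are polynomials in \<open>t\<close> of degree less than \<open>r\<close>, and
  they agree at the \<open>r\<close> nodes because there the Lagrange polynomials take the values 0
  and 1.\<close>

lemma lagrange_interpolation:
  assumes "degree p < r"
  shows "(\<Sum>s<r. poly p (of_nat s) * lagrange s r t) = poly p t"
proof -
  have "\<forall>s\<in>{..<r}. \<exists>l. degree l < r \<and> (\<forall>t. lagrange s r t = poly l t)"
  proof
    fix s assume "s \<in> {..<r}"
    then obtain l where "degree l < r" "\<And>t. lagrange s r t = poly l t"
      using lagrange_poly[of s r] by blast
    then show "\<exists>l. degree l < r \<and> (\<forall>t. lagrange s r t = poly l t)"
      by blast
  qed
  from bchoice[OF this] obtain l
    where l: "\<And>s. s < r \<Longrightarrow> degree (l s) < r" "\<And>s t. s < r \<Longrightarrow> lagrange s r t = poly (l s) t"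
    by auto
  define P where "P = (\<Sum>s<r. smult (poly p (of_nat s)) (l s))"
  have P: "poly P t = (\<Sum>s<r. poly p (of_nat s) * lagrange s r t)" for t
    by (simp add: P_def poly_sum l(2))
  have "P = p"
  proof (rule poly_eqI_degree)
    fix u :: complex assume "u \<in> of_nat ` {..<r}"
    then obtain q where q: "u = of_nat q" "q < r" by auto
    have "poly P u = (\<Sum>s<r. if s = q then poly p (of_nat s) else 0)"
      unfolding P q(1) by (intro sum.cong) (auto simp: lagrange_of_nat q)
    then show "poly P u = poly p u"
      using q by simp
  next
    have c: "card (of_nat ` {..<r} :: complex set) = r"
      by (simp add: card_image inj_on_def)
    \<comment> \<open>The degree bound for sums is not strict, hence \<open>r - 1\<close>; this is
      below \<open>r\<close> because \<open>degree p < r\<close> makes \<open>r\<close>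
      positive.\<close>
    have "degree (smult (poly p (of_nat s)) (l s)) \<le> r - 1" if "s < r" for s
      using l(1)[OF that] degree_smult_le[of "poly p (of_nat s)" "l s"] by linarith
    then have "degree P \<le> r - 1"
      unfolding P_def by (intro degree_sum_le) auto
    then show "degree P < card (of_nat ` {..<r} :: complex set)" "degree p < card (of_nat ` {..<r} :: complex set)"
      using assms c by auto
  qed
  then have "poly P t = poly p t"
    by simp
  then show ?thesis
    unfolding P .
qed

text \<open>Composition with \<open>[:u, 1:]\<close> preserves the degree, so interpolation applies
  to the translated polynomial.\<close>

lemma lagrange_convolution:
  assumes "j < r"
  shows "(\<Sum>s<r. lagrange j r (u + of_nat s) * lagrange s r t) = lagrange j r (u + t)"
proof -
  obtain p where p: "degree p < r" "\<And>t. lagrange j r t = poly p t"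
    using lagrange_poly[OF assms] by blast
  have "degree (pcompose p [:u, 1:]) < r"
    using p by (simp add: degree_pcompose)
  from lagrange_interpolation[OF this] show ?thesis
    by (simp add: p(2)[symmetric] poly_pcompose)
qed

section \<open>The matrix of a loop\<close>

text \<open>This is the sum of the Kronecker products of \<open>X m\<close> with
  \<open>a powi m\<close> times a Lagrange matrix. The latter is translation by \<open>m\<close> on
  polynomials of degree less than \<open>r\<close>: multiplied by it from the right, the row of
  values at \<open>0, ..., r - 1\<close> becomes the row of values at
  \<open>m, ..., m + r - 1\<close>.\<close>

definition loop_mat :: "complex \<Rightarrow> nat \<Rightarrow> loop \<Rightarrow> nat \<times> nat \<Rightarrow> nat \<times> nat \<Rightarrow> complex" where
  "loop_mat a r X p q = (\<Sum>m | X m \<noteq> 0.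
    X m (fst p) (fst q) * (a powi m * lagrange (snd p) r (of_int m + of_nat (snd q))))"

text \<open>Loops with different supports can thus be compared over one common index set.\<close>

lemma loop_mat_eq:
  assumes "finite A" "{m. X m \<noteq> 0} \<subseteq> A"
  shows "loop_mat a r X p q = (\<Sum>m\<in>A.
    X m (fst p) (fst q) * (a powi m * lagrange (snd p) r (of_int m + of_nat (snd q))))"
  unfolding loop_mat_def by (rule sum.mono_neutral_left) (use assms in auto)

lemma psi_eq_quadratic: "psi a n r X = V.quadratic n r (loop_mat a r X)"
proof -
  define F where "F v m i k j s = ext_scale (X m i k * (a powi m * lagrange j r (of_int m + of_nat s)))
    (x_var r i j \<odot> partial_x n r k s v)" for v m i k j s
  have "psi a n r X v = V.quadratic n r (loop_mat a r X) v" if v: "v \<in> ext_V n r" for v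
  proof -
    have "psi a n r X v = (\<Sum>m | X m \<noteq> 0. \<Sum>i=1..n. \<Sum>k=1..n. \<Sum>j<r. \<Sum>s<r. F v m i k j s)"
      using v by (simp add: psi_def psi_unit_def F_def ext.scale_sum_right)
    \<comment> \<open>The exchanges pair \<open>i\<close> with \<open>j\<close> and \<open>k\<close>
      with \<open>s\<close>, as \<open>sum_vars\<close> requires, and move the sum over
      \<open>m\<close> inside, where it collects into an entry of \<open>loop_mat\<close>.\<close>
    also have "\<dots> = (\<Sum>i=1..n. \<Sum>m | X m \<noteq> 0. \<Sum>k=1..n. \<Sum>j<r. \<Sum>s<r. F v m i k j s)"
      by (rule sum.swap)
    also have "\<dots> = (\<Sum>i=1..n. \<Sum>m | X m \<noteq> 0. \<Sum>j<r. \<Sum>k=1..n. \<Sum>s<r. F v m i k j s)"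
      by (intro sum.cong refl sum.swap)
    also have "\<dots> = (\<Sum>i=1..n. \<Sum>j<r. \<Sum>m | X m \<noteq> 0. \<Sum>k=1..n. \<Sum>s<r. F v m i k j s)"
      by (intro sum.cong refl sum.swap)
    also have "\<dots> = (\<Sum>i=1..n. \<Sum>j<r. \<Sum>k=1..n. \<Sum>m | X m \<noteq> 0. \<Sum>s<r. F v m i k j s)"
      by (intro sum.cong refl sum.swap)
    also have "\<dots> = (\<Sum>i=1..n. \<Sum>j<r. \<Sum>k=1..n. \<Sum>s<r. \<Sum>m | X m \<noteq> 0. F v m i k j s)"
      by (intro sum.cong refl sum.swap)
    also have "\<dots> = (\<Sum>p\<in>vars n r. \<Sum>q\<in>vars n r. \<Sum>m | X m \<noteq> 0. F v m (fst p) (fst q) (snd p) (snd q))"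
      by (simp add: sum_vars)
    also have "\<dots> = V.quadratic n r (loop_mat a r X) v"
      using v by (simp add: V.quadratic_def loop_mat_def F_def ext.scale_sum_left)
    finally show ?thesis .
  qed
  then show ?thesis
    by (auto simp: psi_def V.quadratic_def fun_eq_iff[where 'a = "(nat \<times> nat) ext"])
qed

text \<open>Summing over the first component of \<open>l\<close> gives the matrix product, over the
  second the convolution of Lagrange values. The powers of \<open>a\<close> with integer exponents
  multiply because \<open>a \<noteq> 0\<close>.\<close>

lemma loop_mat_mult:
  assumes "a \<noteq> 0" "p \<in> vars n r" "q \<in> vars n r"
  shows "(\<Sum>l\<in>vars n r. loop_mat a r X p l * loop_mat a r Y l q)
    = (\<Sum>m | X m \<noteq> 0. \<Sum>m' | Y m' \<noteq> 0. mat_prod n (X m) (Y m') (fst p) (fst q)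
        * (a powi (m + m') * lagrange (snd p) r (of_int (m + m') + of_nat (snd q))))"
proof -
  have j: "snd p < r" using assms by (auto simp: vars_def)
  have "(\<Sum>l\<in>vars n r. (X m (fst p) (fst l) * (a powi m * lagrange (snd p) r (of_int m + of_nat (snd l))))
        * (Y m' (fst l) (fst q) * (a powi m' * lagrange (snd l) r (of_int m' + of_nat (snd q)))))
      = mat_prod n (X m) (Y m') (fst p) (fst q)
        * (a powi (m + m') * lagrange (snd p) r (of_int (m + m') + of_nat (snd q)))" (is "?L = _") for m m'
  proof -
    have "?L = (\<Sum>l=1..n. \<Sum>s<r. (X m (fst p) l * Y m' l (fst q)) * (a powi (m + m') *
        (lagrange (snd p) r (of_int m + of_nat s) * lagrange s r (of_int m' + of_nat (snd q)))))"
      unfolding sum_vars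
      using assms(1) by (intro sum.cong) (auto simp: power_int_add)
    also have "\<dots> = (\<Sum>l=1..n. (X m (fst p) l * Y m' l (fst q)) * (a powi (m + m') *
        lagrange (snd p) r (of_int m + (of_int m' + of_nat (snd q)))))"
      by (simp only: lagrange_convolution[OF j] flip: sum_distrib_left)
    finally show ?thesis
      by (simp add: mat_prod_def sum_distrib_right add.assoc)
  qed
  note * = this
  have "(\<Sum>l\<in>vars n r. loop_mat a r X p l * loop_mat a r Y l q)
    = (\<Sum>l\<in>vars n r. \<Sum>m | X m \<noteq> 0. \<Sum>m' | Y m' \<noteq> 0.
        (X m (fst p) (fst l) * (a powi m * lagrange (snd p) r (of_int m + of_nat (snd l))))
        * (Y m' (fst l) (fst q) * (a powi m' * lagrange (snd l) r (of_int m' + of_nat (snd q)))))"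
    unfolding loop_mat_def sum_product ..
  also have "\<dots> = (\<Sum>m | X m \<noteq> 0. \<Sum>l\<in>vars n r. \<Sum>m' | Y m' \<noteq> 0.
        (X m (fst p) (fst l) * (a powi m * lagrange (snd p) r (of_int m + of_nat (snd l))))
        * (Y m' (fst l) (fst q) * (a powi m' * lagrange (snd l) r (of_int m' + of_nat (snd q)))))"
    by (rule sum.swap)
  also have "\<dots> = (\<Sum>m | X m \<noteq> 0. \<Sum>m' | Y m' \<noteq> 0. \<Sum>l\<in>vars n r.
        (X m (fst p) (fst l) * (a powi m * lagrange (snd p) r (of_int m + of_nat (snd l))))
        * (Y m' (fst l) (fst q) * (a powi m' * lagrange (snd l) r (of_int m' + of_nat (snd q)))))"
    by (intro sum.cong refl sum.swap)
  finally show ?thesis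
    unfolding * .
qed

text \<open>In \<open>loop_mat_mult\<close> the weight of a pair of degrees depends on their sum
  alone. Hence both orders of multiplication carry the same weight, and the matrix products combine
  to the commutators that make up the loop bracket.\<close>

lemma loop_mat_bracket:
  assumes a: "a \<noteq> 0" and p: "p \<in> vars n r" and q: "q \<in> vars n r"
    and X: "finite {m. X m \<noteq> 0}" and Y: "finite {m. Y m \<noteq> 0}"
    and Z: "finite {m. loop_bracket n X Y m \<noteq> 0}"
  shows "loop_mat a r (loop_bracket n X Y) p q
    = (\<Sum>l\<in>vars n r. loop_mat a r X p l * loop_mat a r Y l q - loop_mat a r Y p l * loop_mat a r X l q)"
proof -
  define A B where "A = {m. X m \<noteq> 0}" and "B = {m. Y m \<noteq> 0}"
  \<comment> \<open>The sums \<open>m + m'\<close> are included even where the bracket vanishes, so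
    that for each pair the condition \<open>t = m + m'\<close> selects exactly one \<open>t\<close>
    in \<open>C\<close>.\<close>
  define C where "C = {m. loop_bracket n X Y m \<noteq> 0} \<union> (\<lambda>(m, m'). m + m') ` (A \<times> B)"
  define w where "w t = a powi t * lagrange (snd p) r (of_int t + of_nat (snd q))" for t
  have C: "finite C" "\<And>m m'. m \<in> A \<Longrightarrow> m' \<in> B \<Longrightarrow> m + m' \<in> C"
    using X Y Z by (auto simp: C_def A_def B_def)
  have "loop_mat a r (loop_bracket n X Y) p q = (\<Sum>t\<in>C. loop_bracket n X Y t (fst p) (fst q) * w t)"
    unfolding w_def by (rule loop_mat_eq[OF C(1)]) (auto simp: C_def)
  also have "\<dots> = (\<Sum>t\<in>C. \<Sum>m\<in>A. \<Sum>m'\<in>B.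
      if t = m + m' then mat_comm n (X m) (Y m') (fst p) (fst q) * w t else 0)"
    unfolding loop_bracket_eq[OF X Y order_refl order_refl] A_def[symmetric] B_def[symmetric]
      sum_fun_apply sum_distrib_right
    by (intro sum.cong refl) simp
  also have "\<dots> = (\<Sum>m\<in>A. \<Sum>t\<in>C. \<Sum>m'\<in>B.
      if t = m + m' then mat_comm n (X m) (Y m') (fst p) (fst q) * w t else 0)"
    by (rule sum.swap)
  also have "\<dots> = (\<Sum>m\<in>A. \<Sum>m'\<in>B. \<Sum>t\<in>C.
      if t = m + m' then mat_comm n (X m) (Y m') (fst p) (fst q) * w t else 0)"
    by (intro sum.cong refl sum.swap)
  also have "\<dots> = (\<Sum>m\<in>A. \<Sum>m'\<in>B. mat_comm n (X m) (Y m') (fst p) (fst q) * w (m + m'))"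
    by (intro sum.cong refl) (simp add: C sum.delta)
  also have "\<dots> = (\<Sum>m\<in>A. \<Sum>m'\<in>B. mat_prod n (X m) (Y m') (fst p) (fst q) * w (m + m'))
      - (\<Sum>m\<in>A. \<Sum>m'\<in>B. mat_prod n (Y m') (X m) (fst p) (fst q) * w (m + m'))"
    by (simp add: mat_comm_def left_diff_distrib sum_subtractf)
  also have "(\<Sum>m\<in>A. \<Sum>m'\<in>B. mat_prod n (Y m') (X m) (fst p) (fst q) * w (m + m'))
      = (\<Sum>m'\<in>B. \<Sum>m\<in>A. mat_prod n (Y m') (X m) (fst p) (fst q) * w (m' + m))"
    by (subst sum.swap) (simp add: add.commute)
  finally show ?thesis
    unfolding sum_subtractf loop_mat_mult[OF a p q] w_def A_def B_def .
qed

section \<open>The homomorphism property\<close>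

theorem proposition4p1:
  fixes n r :: nat and a :: complex
  assumes "n \<ge> 2" and "r \<ge> 1" and "a \<noteq> 0"
  shows "lie_algebra_hom (loop_gl n) (End_lie (ext_V n r)) (psi a n r)"
proof -
  interpret L: complex_lie_algebra "loop_gl n"
    by (rule complex_lie_algebra_loop_gl)
  interpret M: complex_lie_algebra "End_lie (ext_V n r)"
    by (rule complex_lie_algebra_End)
  have fin: "finite {m. X m \<noteq> 0}" if "X \<in> lcarrier (loop_gl n)" for X
    using that by (simp add: loop_gl_def)
  show ?thesis
  proof
    show "psi a n r X \<in> lcarrier (End_lie (ext_V n r))" for X
      by (simp add: psi_eq_quadratic End_lie_def V.quadratic_End)
  next
    fix X Y assume X: "X \<in> lcarrier (loop_gl n)" and Y: "Y \<in> lcarrier (loop_gl n)"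
    define A where "A = {m. X m \<noteq> 0} \<union> {m. Y m \<noteq> 0}"
    have A: "finite A" "{m. X m \<noteq> 0} \<subseteq> A" "{m. Y m \<noteq> 0} \<subseteq> A" "{m. (X + Y) m \<noteq> 0} \<subseteq> A"
      using fin[OF X] fin[OF Y] by (auto simp: A_def)
    have "loop_mat a r (X + Y) p q = loop_mat a r X p q + loop_mat a r Y p q" for p q
      unfolding loop_mat_eq[OF A(1,2)] loop_mat_eq[OF A(1,3)] loop_mat_eq[OF A(1,4)]
      by (simp add: distrib_right sum.distrib)
    then have "loop_mat a r (X + Y) = (\<lambda>p q. loop_mat a r X p q + loop_mat a r Y p q)"
      by blast
    then show "psi a n r (ladd (loop_gl n) X Y) = ladd (End_lie (ext_V n r)) (psi a n r X) (psi a n r Y)"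
      by (simp add: psi_eq_quadratic loop_gl_def End_lie_def V.quadratic_add)
    have Z: "finite {m. loop_bracket n X Y m \<noteq> 0}"
      using fin[OF L.bracket_closed[OF X Y]] by (simp add: loop_gl_def)
    have "psi a n r (loop_bracket n X Y) = V.quadratic n r (\<lambda>p q. \<Sum>l\<in>vars n r.
        loop_mat a r X p l * loop_mat a r Y l q - loop_mat a r Y p l * loop_mat a r X l q)"
      unfolding psi_eq_quadratic
      by (rule V.quadratic_cong) (rule loop_mat_bracket[OF assms(3) _ _ fin[OF X] fin[OF Y] Z])
    also have "\<dots> = (\<lambda>v\<in>ext_V n r. psi a n r X (psi a n r Y v) - psi a n r Y (psi a n r X v))"
      unfolding psi_eq_quadratic
      \<comment> \<open>The first simplification treats vectors of the space; outside it both sides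
        are \<open>undefined\<close>, which the second one confirms.\<close>
      by (rule ext) (simp add: V.quadratic_commutator, simp add: V.quadratic_def)
    finally show "psi a n r (lbracket (loop_gl n) X Y)
        = lbracket (End_lie (ext_V n r)) (psi a n r X) (psi a n r Y)"
      by (simp add: loop_gl_def End_lie_def)
  next
    fix X c assume X: "X \<in> lcarrier (loop_gl n)"
    \<comment> \<open>For \<open>c = 0\<close> the support of the multiple becomes empty, so both
      sums are taken over the support of \<open>X\<close>.\<close>
    have "{m. loop_scale c X m \<noteq> 0} \<subseteq> {m. X m \<noteq> 0}"
      by (auto simp: loop_scale_def fun_eq_iff)
    then have "loop_mat a r (loop_scale c X) = (\<lambda>p q. c * loop_mat a r X p q)"
      using fin[OF X]
      by (intro ext) (simp add: loop_mat_eq[of "{m. X m \<noteq> 0}"] loop_scale_def sum_distrib_left mult.assoc)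
    then show "psi a n r (lscale (loop_gl n) c X) = lscale (End_lie (ext_V n r)) c (psi a n r X)"
      by (simp add: psi_eq_quadratic loop_gl_def End_lie_def V.quadratic_scale)
  qed
qed

end
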